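(* If $\mathcal{T}$ is a Delaunay triangulation of a closed hyperbolic polyhedral surface $(S,V,d)$, then each triangle of $\mathcal{T}$ has a compact circumcircle.
   Context: $S$ is a closed connected surface and $V\subset S$ is a finite non-empty subset. A triangulation of $(S,V)$ is obtained by identifying edges of a finite disjoint union of triangles in pairs so that the quotient is $S$ and the vertex set is $V$. A hyperbolic polyhedral metric $d$ on $(S,V)$ is a metric obtained by gluing hyperbolic triangles isometrically along pairs of edges, with all cone points in $V$. A triangulation is geodesic in $d$ if each of its triangles is isometric to a hyperbolic triangle. The circumcircle of a hyperbolic triangle in $\mathbf{H}^2$ is the curve of constant geodesic curvature through its three vertices; it is either a (compact) hyperbolic circle, or non-compact: a horocycle or a curve of constant distance to a geodesic. The circum-ball is the convex region bounded by the circumcircle. A geodesic triangulation $\mathcal{T}$ of $(S,V,d)$ is Delaunay if for each edge $e$ adjacent to two triangles $t,t'$, when the quadrilateral $t\cup_e t'$ is lifted to $\mathbf{H}^2$, the interior of the circum-ball of $t$ does not contain the vertices of $t'$. *)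

theory Defs
  imports "HOL-Analysis.Analysis"
begin

section \<open>The hyperbolic plane (hyperboloid model)\<close>

definition lorentz :: "real^3 \<Rightarrow> real^3 \<Rightarrow> real" where
  "lorentz x y = x$1 * y$1 + x$2 * y$2 - x$3 * y$3"

definition H2 :: "(real^3) set" where
  "H2 = {x. lorentz x x = -1 \<and> x$3 > 0}"

text \<open>The topology of the metric \<open>hdist\<close> on \<open>H2\<close> is the subspace topology of \<open>real^3\<close>.\<close>

definition hdist :: "real^3 \<Rightarrow> real^3 \<Rightarrow> real" where
  "hdist x y = arcosh (- lorentz x y)"

definition hseg :: "real^3 \<Rightarrow> real^3 \<Rightarrow> (real^3) set" where
  "hseg x y = {z \<in> H2. hdist x z + hdist z y = hdist x y}"

definition hcollinear :: "real^3 \<Rightarrow> real^3 \<Rightarrow> real^3 \<Rightarrow> bool" where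
  "hcollinear x y z \<longleftrightarrow> x \<in> hseg y z \<or> y \<in> hseg x z \<or> z \<in> hseg x y"

definition hconvex :: "(real^3) set \<Rightarrow> bool" where
  "hconvex B \<longleftrightarrow> B \<subseteq> H2 \<and> (\<forall>x\<in>B. \<forall>y\<in>B. hseg x y \<subseteq> B)"

definition isometric_embedding :: "(real^3) set \<Rightarrow> (real^3 \<Rightarrow> real^3) \<Rightarrow> bool" where
  "isometric_embedding A g \<longleftrightarrow>
     g ` A \<subseteq> H2 \<and> (\<forall>x\<in>A. \<forall>y\<in>A. hdist (g x) (g y) = hdist x y)"

text \<open>
  A hyperbolic triangle is given by its vertices \<open>v :: 3 \<Rightarrow> real^3\<close>. Indices are taken modulo 3;
  side \<open>k\<close> is the one opposite to vertex \<open>k\<close>.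
\<close>

definition hyperbolic_triangle :: "(3 \<Rightarrow> real^3) \<Rightarrow> bool" where
  "hyperbolic_triangle v \<longleftrightarrow> range v \<subseteq> H2 \<and> \<not> hcollinear (v 1) (v 2) (v 3)"

definition triangle_region :: "(3 \<Rightarrow> real^3) \<Rightarrow> (real^3) set" where
  "triangle_region v = hconvex hull (range v)"

definition triangle_side :: "(3 \<Rightarrow> real^3) \<Rightarrow> 3 \<Rightarrow> (real^3) set" where
  "triangle_side v k = hseg (v (k + 1)) (v (k + 2))"

section \<open>Circumcircles and circum-balls\<close>

text \<open>
  For a unit speed curve \<open>\<gamma>\<close> in \<open>H2\<close>, the unit normal \<open>J \<gamma>'\<close> of \<open>\<gamma>\<close> in the tangent plane of \<open>H2\<close>
  is (for one of the two orientations) the Lorentzian cross product of \<open>\<gamma>\<close> and \<open>\<gamma>'\<close>, and the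
  covariant acceleration is the Lorentz-orthogonal projection of \<open>\<gamma>''\<close> to that tangent plane.
  Hence the signed geodesic curvature \<open>lorentz \<gamma>'' (J \<gamma>')\<close> is the determinant with rows
  \<open>\<gamma>, \<gamma>', \<gamma>''\<close>.
\<close>

definition velocity :: "(real \<Rightarrow> real^3) \<Rightarrow> real \<Rightarrow> real^3" where
  "velocity \<gamma> s = vector_derivative \<gamma> (at s)"

definition geodesic_curvature :: "(real \<Rightarrow> real^3) \<Rightarrow> real \<Rightarrow> real" where
  "geodesic_curvature \<gamma> s =
     det (vector [\<gamma> s, velocity \<gamma> s, velocity (velocity \<gamma>) s] :: real^3^3)"

definition unit_speed_curve :: "(real \<Rightarrow> real^3) \<Rightarrow> bool" where
  "unit_speed_curve \<gamma> \<longleftrightarrow>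
     (\<forall>s. \<gamma> s \<in> H2 \<and> \<gamma> differentiable at s \<and> velocity \<gamma> differentiable at s \<and>
          lorentz (velocity \<gamma> s) (velocity \<gamma> s) = 1)"

text \<open>
  The parameter runs through all of \<open>\<real>\<close>, so these are the complete curves: circles, horocycles,
  curves of constant distance to a geodesic, and geodesics.
\<close>

definition constant_curvature_curve :: "(real^3) set \<Rightarrow> bool" where
  "constant_curvature_curve C \<longleftrightarrow>
     (\<exists>\<gamma> \<kappa>. unit_speed_curve \<gamma> \<and> (\<forall>s. geodesic_curvature \<gamma> s = \<kappa>) \<and> C = range \<gamma>)"

definition circumcircle :: "(3 \<Rightarrow> real^3) \<Rightarrow> (real^3) set" where
  "circumcircle v = (THE C. constant_curvature_curve C \<and> range v \<subseteq> C)"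

text \<open>
  Only one of the closed regions bounded by the circumcircle of a non-degenerate triangle is
  convex, because the curvature of the circumcircle is not zero.
\<close>

definition circumball :: "(3 \<Rightarrow> real^3) \<Rightarrow> (real^3) set" where
  "circumball v = (THE B. hconvex B \<and> closedin (top_of_set H2) B \<and>
                          top_of_set H2 frontier_of B = circumcircle v)"

section \<open>Triangulated surfaces\<close>

definition closed_connected_surface :: "'s topology \<Rightarrow> bool" where
  "closed_connected_surface S \<longleftrightarrow>
     compact_space S \<and> connected_space S \<and> Hausdorff_space S \<and>
     (\<forall>x\<in>topspace S. \<exists>U. openin S U \<and> x \<in> U \<and>
        subtopology S U homeomorphic_space (euclidean :: (real^2) topology))"

text \<open>
  A side is a pair \<open>(i, k)\<close> of a face \<open>i\<close> and the index \<open>k\<close> of a side of that face. Side \<open>s\<close> is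
  identified with side \<open>mate s\<close> through the map \<open>glue s\<close>, and \<open>chart\<close> maps the disjoint union
  of the faces to the surface. In a merely topological triangulation the hyperbolic triangles
  only serve as topological models of the faces.
\<close>

record ('i, 's) triangulated =
  faces :: "'i set"
  verts :: "'i \<Rightarrow> 3 \<Rightarrow> real^3"
  mate :: "'i \<times> 3 \<Rightarrow> 'i \<times> 3"
  glue :: "'i \<times> 3 \<Rightarrow> real^3 \<Rightarrow> real^3"
  chart :: "'i \<times> (real^3) \<Rightarrow> 's"

definition face :: "('i, 's) triangulated \<Rightarrow> 'i \<Rightarrow> (real^3) set" where
  "face T i = triangle_region (verts T i)"

definition sides :: "('i, 's) triangulated \<Rightarrow> ('i \<times> 3) set" where
  "sides T = faces T \<times> UNIV"

definition side :: "('i, 's) triangulated \<Rightarrow> 'i \<times> 3 \<Rightarrow> (real^3) set" where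
  "side T s = triangle_side (verts T (fst s)) (snd s)"

text \<open>This relation is symmetric for a triangulation, as \<open>glue (mate s)\<close> is inverse to \<open>glue s\<close>.\<close>

definition glue_rel :: "('i, 's) triangulated \<Rightarrow> (('i \<times> (real^3)) \<times> ('i \<times> (real^3))) set" where
  "glue_rel T = {((fst s, x), (fst (mate T s), glue T s x)) | s x. s \<in> sides T \<and> x \<in> side T s}"

definition triangulation :: "'s topology \<Rightarrow> 's set \<Rightarrow> ('i, 's) triangulated \<Rightarrow> bool" where
  "triangulation S V T \<longleftrightarrow>
     finite (faces T) \<and>
     (\<forall>i\<in>faces T. hyperbolic_triangle (verts T i)) \<and>
     (\<forall>s\<in>sides T. mate T s \<in> sides T \<and> mate T s \<noteq> s \<and> mate T (mate T s) = s \<and>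
        homeomorphism (side T s) (side T (mate T s)) (glue T s) (glue T (mate T s))) \<and>
     quotient_map (sum_topology (\<lambda>i. top_of_set (face T i)) (faces T)) S (chart T) \<and>
     (\<forall>p\<in>Sigma (faces T) (face T). \<forall>q\<in>Sigma (faces T) (face T).
        chart T p = chart T q \<longleftrightarrow> (p, q) \<in> (glue_rel T)\<^sup>*) \<and>
     V = {chart T (i, verts T i k) | i k. i \<in> faces T}"

section \<open>Hyperbolic polyhedral metrics\<close>

text \<open>
  The glued metric is the quotient metric: the infimum of the lengths of broken paths, each piece
  of which joins two points of the same face.
\<close>

inductive broken_path :: "('i, 's) triangulated \<Rightarrow> 's \<Rightarrow> real \<Rightarrow> 's \<Rightarrow> bool"
  for T :: "('i, 's) triangulated" where
  refl: "broken_path T a 0 a"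
| step: "\<lbrakk>i \<in> faces T; x \<in> face T i; y \<in> face T i; broken_path T (chart T (i, y)) l b\<rbrakk>
         \<Longrightarrow> broken_path T (chart T (i, x)) (hdist x y + l) b"

definition glued_dist :: "('i, 's) triangulated \<Rightarrow> 's \<Rightarrow> 's \<Rightarrow> real" where
  "glued_dist T a b = Inf {l. broken_path T a l b}"

text \<open>
  \<open>T\<close> is geodesic in \<open>d\<close> if its faces, with the length metrics induced from \<open>d\<close>, are the hyperbolic
  triangles \<open>verts T i\<close>, that is, if \<open>d\<close> is obtained by gluing these triangles isometrically
  along their sides.
\<close>

definition geodesic_in ::
    "'s topology \<Rightarrow> ('s \<Rightarrow> 's \<Rightarrow> real) \<Rightarrow> ('i, 's) triangulated \<Rightarrow> bool" where
  "geodesic_in S d T \<longleftrightarrow>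
     (\<forall>s\<in>sides T. isometric_embedding (side T s) (glue T s)) \<and>
     (\<forall>a\<in>topspace S. \<forall>b\<in>topspace S. d a b = glued_dist T a b)"

definition cone_point :: "'s topology \<Rightarrow> ('s \<Rightarrow> 's \<Rightarrow> real) \<Rightarrow> 's \<Rightarrow> bool" where
  "cone_point S d a \<longleftrightarrow> a \<in> topspace S \<and>
     \<not> (\<exists>r>0. \<exists>f. f a \<in> H2 \<and>
          bij_betw f {b \<in> topspace S. d a b < r} {z \<in> H2. hdist (f a) z < r} \<and>
          (\<forall>b\<in>topspace S. \<forall>c\<in>topspace S. d a b < r \<and> d a c < r \<longrightarrow> hdist (f b) (f c) = d b c))"

text \<open>
  The triangulation \<open>T\<close> by which the metric is glued may have a vertex set \<open>W\<close> different from \<open>V\<close>.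
  The index type \<open>nat\<close> is no restriction, because triangulations have finitely many faces.
\<close>

definition hyperbolic_polyhedral_metric :: "'s topology \<Rightarrow> 's set \<Rightarrow> ('s \<Rightarrow> 's \<Rightarrow> real) \<Rightarrow> bool" where
  "hyperbolic_polyhedral_metric S V d \<longleftrightarrow>
     Metric_space (topspace S) d \<and> Metric_space.mtopology (topspace S) d = S \<and>
     (\<exists>(T :: (nat, 's) triangulated) W. triangulation S W T \<and> geodesic_in S d T) \<and>
     (\<forall>a. cone_point S d a \<longrightarrow> a \<in> V)"

definition closed_hyperbolic_polyhedral_surface ::
    "'s topology \<Rightarrow> 's set \<Rightarrow> ('s \<Rightarrow> 's \<Rightarrow> real) \<Rightarrow> bool" where
  "closed_hyperbolic_polyhedral_surface S V d \<longleftrightarrow>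
     closed_connected_surface S \<and> V \<subseteq> topspace S \<and> finite V \<and> V \<noteq> {} \<and>
     hyperbolic_polyhedral_metric S V d"

section \<open>Delaunay triangulations\<close>

text \<open>
  A lift of the quadrilateral formed by the two faces along side \<open>s\<close>: the two faces are placed in
  \<open>H2\<close> so that identified points of the common edge coincide and nothing else overlaps, i.e. the
  faces lie on different sides of the edge. The two faces may be copies of the same one.
\<close>

definition quadrilateral_lift ::
    "('i, 's) triangulated \<Rightarrow> 'i \<times> 3 \<Rightarrow> (real^3 \<Rightarrow> real^3) \<Rightarrow> (real^3 \<Rightarrow> real^3) \<Rightarrow> bool" where
  "quadrilateral_lift T s g g' \<longleftrightarrow>
     isometric_embedding (face T (fst s)) g \<and>
     isometric_embedding (face T (fst (mate T s))) g' \<and>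
     (\<forall>x\<in>side T s. g' (glue T s x) = g x) \<and>
     g ` face T (fst s) \<inter> g' ` face T (fst (mate T s)) = g ` side T s"

definition delaunay :: "('i, 's) triangulated \<Rightarrow> bool" where
  "delaunay T \<longleftrightarrow>
     (\<forall>s\<in>sides T. \<forall>g g'. quadrilateral_lift T s g g' \<longrightarrow>
        (\<forall>k. g' (verts T (fst (mate T s)) k)
               \<notin> top_of_set H2 interior_of circumball (g \<circ> verts T (fst s))))"

definition delaunay_triangulation ::
    "'s topology \<Rightarrow> 's set \<Rightarrow> ('s \<Rightarrow> 's \<Rightarrow> real) \<Rightarrow> ('i, 's) triangulated \<Rightarrow> bool" where
  "delaunay_triangulation S V d T \<longleftrightarrow> triangulation S V T \<and> geodesic_in S d T \<and> delaunay T"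

end

theory Submission
  imports Defs
begin

text \<open>
  In the hyperboloid model the circumcircle of a triangle is the section of \<open>H2\<close> by the plane through
  its vertices, and the circum-ball is the part of \<open>H2\<close> on the same side of that plane as the
  origin. The metric induced on the plane makes the vertices a triangle with side lengths
  \<open>2 sinh (l / 2)\<close>, where \<open>l\<close> runs over the hyperbolic side lengths. If these chord lengths satisfy
  the strict triangle inequalities, the plane is spacelike and the section is compact. Otherwise some
  side is at least as long as the two others together. The Delaunay condition at such a side forces
  the neighbouring triangle to have such a side as well, which is strictly longer. As there are
  finitely many sides, this is impossible.
\<close>

section \<open>The Lorentz form and the hyperboloid\<close>

text \<open>\<open>circumcircle\<close> and \<open>circumball\<close> are definite descriptions, so
  nothing can be said about them before existence and uniqueness are settled. Much of the
  development serves this: complete curves of constant curvature are identified with plane sections,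
  and a closed convex set with such a frontier with a half-space. The plane of a triangle misses the
  origin, so it can be written \<open>lorentz x n = 1\<close>; the open ball becomes
  \<open>lorentz x n < 1\<close>, and the Delaunay condition a linear inequality for the opposite
  vertex. That condition speaks about lifts of two adjacent triangles and is vacuous without one, so
  a Lorentz isometry that unfolds them is built explicitly. On the directions of the plane the form
  is degenerate for horocycles and indefinite for equidistant curves; these are the cases in which a
  strict triangle inequality fails. Across a long side of chord a, the other two chords p and q of
  the neighbour satisfy p \<ge> a + q up to exchange, and q > 0 makes the growth strict.\<close>

lemma lorentz_commute: "lorentz x y = lorentz y x"
  by (simp add: lorentz_def mult.commute)

lemma bounded_bilinear_lorentz: "bounded_bilinear lorentz"
proof
  show "\<exists>K. \<forall>a b. norm (lorentz a b) \<le> norm a * norm b * K"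
  proof (intro exI allI)
    fix a b :: "real^3"
    have *: "\<bar>a$i * b$i\<bar> \<le> norm a * norm b" for i
      by (simp add: abs_mult component_le_norm_cart mult_mono)
    show "norm (lorentz a b) \<le> norm a * norm b * 3"
      using *[of 1] *[of 2] *[of 3] unfolding lorentz_def real_norm_def by linarith
  qed
qed (auto simp: lorentz_def algebra_simps)

interpretation lorentz: bounded_bilinear lorentz
  by (rule bounded_bilinear_lorentz)

lemmas lorentz_simps = lorentz.add_left lorentz.add_right lorentz.diff_left lorentz.diff_right
  lorentz.scaleR_left lorentz.scaleR_right lorentz.minus_left lorentz.minus_right

text \<open>The Euclidean cross product with the third component negated. The sign makes it Lorentz
  orthogonal to both factors, and \<open>lorentz z (lcross x y)\<close> is the determinant of x, y,
  z.\<close>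

definition lcross :: "real^3 \<Rightarrow> real^3 \<Rightarrow> real^3" where
  "lcross x y = vector [x$2 * y$3 - x$3 * y$2, x$3 * y$1 - x$1 * y$3, x$2 * y$1 - x$1 * y$2]"

lemma det_eq_lorentz_lcross: "det (vector [x, y, z] :: real^3^3) = lorentz z (lcross x y)"
  by (simp add: det_3 vector_3 lorentz_def lcross_def algebra_simps)

lemma bounded_bilinear_lcross: "bounded_bilinear lcross"
proof
  show "\<exists>K. \<forall>a b. norm (lcross a b) \<le> norm a * norm b * K"
  proof (intro exI allI)
    fix a b :: "real^3"
    have *: "\<bar>a$i * b$j\<bar> \<le> norm a * norm b" for i j
      by (simp add: abs_mult component_le_norm_cart mult_mono)
    have d: "\<bar>a$i * b$j - a$k * b$l\<bar> \<le> norm a * norm b * 2" for i j k l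
      using abs_triangle_ineq4[of "a$i * b$j" "a$k * b$l"] *[of i j] *[of k l] by linarith
    have "norm (lcross a b) \<le> \<bar>lcross a b $ 1\<bar> + \<bar>lcross a b $ 2\<bar> + \<bar>lcross a b $ 3\<bar>"
      using norm_le_l1_cart[of "lcross a b"] by (simp add: sum_3)
    also have "\<dots> \<le> norm a * norm b * 6"
      using d[of 2 3 3 2] d[of 3 1 1 3] d[of 2 1 1 2]
      unfolding lcross_def vector_3 by simp
    finally show "norm (lcross a b) \<le> norm a * norm b * 6" .
  qed
qed (auto simp: lcross_def vec_eq_iff forall_3 vector_3 algebra_simps)

interpretation lcross: bounded_bilinear lcross
  by (rule bounded_bilinear_lcross)

lemma lorentz_lcross_self [simp]:
  "lorentz x (lcross x y) = 0" "lorentz y (lcross x y) = 0"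
  "lorentz (lcross x y) x = 0" "lorentz (lcross x y) y = 0"
  by (simp_all add: lorentz_def lcross_def vector_3 algebra_simps)

lemma lcross_self [simp]: "lcross x x = 0"
  by (simp add: lcross_def vec_eq_iff forall_3 vector_3)

lemma lorentz_lcross_lcross:
  "lorentz (lcross x y) (lcross x y) = (lorentz x y)\<^sup>2 - lorentz x x * lorentz y y"
  by (simp add: lorentz_def lcross_def vector_3 power2_eq_square algebra_simps)

lemma lcross_lcross:
  "lcross x (lcross y z) = lorentz x y *\<^sub>R z - lorentz x z *\<^sub>R y"
  by (simp add: lorentz_def lcross_def vec_eq_iff forall_3 vector_3 algebra_simps)

text \<open>With J = diag(1, 1, -1) the Gram matrix is A J A^T, whose determinant is -(det A)^2. The
  bracket is this Gram determinant.\<close>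

lemma gram_det:
  "(lorentz z (lcross x y))\<^sup>2 =
     - (lorentz x x * lorentz y y * lorentz z z + 2 * lorentz x y * lorentz y z * lorentz x z
        - lorentz x x * (lorentz y z)\<^sup>2 - lorentz y y * (lorentz x z)\<^sup>2 - lorentz z z * (lorentz x y)\<^sup>2)"
  by (simp add: lorentz_def lcross_def vector_3 power2_eq_square algebra_simps)

text \<open>Cramer's rule cleared of its denominator, so that it also yields a linear relation when
  x, y, z are dependent.\<close>

lemma cramer:
  "lorentz x (lcross y z) *\<^sub>R w =
     lorentz w (lcross y z) *\<^sub>R x + lorentz w (lcross z x) *\<^sub>R y + lorentz w (lcross x y) *\<^sub>R z"
  by (simp add: lorentz_def lcross_def vec_eq_iff forall_3 vector_3 algebra_simps)

lemma H2_lorentz: "x \<in> H2 \<Longrightarrow> lorentz x x = -1"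
  by (simp add: H2_def)

text \<open>Lagrange's identity in the first two coordinates. The bound gives both halves of
  positive definiteness on the tangent plane at x: non-negativity, and the vanishing of null
  vectors.\<close>

lemma orthogonal_H2_bound:
  assumes "x \<in> H2" "lorentz x r = 0"
  shows "(r$1)\<^sup>2 + (r$2)\<^sup>2 \<le> lorentz r r * (x$3)\<^sup>2"
proof -
  have 1: "(x$3)\<^sup>2 = 1 + (x$1)\<^sup>2 + (x$2)\<^sup>2" and 2: "r$3 * x$3 = r$1 * x$1 + r$2 * x$2"
    using assms by (auto simp: H2_def lorentz_def power2_eq_square algebra_simps)
  have "(r$3 * x$3)\<^sup>2 + (r$1 * x$2 - r$2 * x$1)\<^sup>2 = ((r$1)\<^sup>2 + (r$2)\<^sup>2) * ((x$3)\<^sup>2 - 1)"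
    unfolding 1 2 by (simp add: power2_eq_square algebra_simps)
  moreover have "0 \<le> (r$1 * x$2 - r$2 * x$1)\<^sup>2" by simp
  ultimately show ?thesis
    by (simp add: lorentz_def power2_eq_square algebra_simps)
qed

lemma orthogonal_H2_nonneg:
  assumes "x \<in> H2" "lorentz x r = 0"
  shows "lorentz r r \<ge> 0"
proof -
  have "0 \<le> lorentz r r * (x$3)\<^sup>2" "(x$3)\<^sup>2 > 0"
    using orthogonal_H2_bound[OF assms] assms(1)
    by (auto simp: H2_def intro: order_trans[rotated])
  then show ?thesis
    by (simp add: zero_le_mult_iff)
qed

lemma orthogonal_H2_eq_0:
  assumes "x \<in> H2" "lorentz x r = 0" "lorentz r r \<le> 0"
  shows "r = 0"
proof -
  have "lorentz r r * (x$3)\<^sup>2 \<le> 0"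
    using assms(3) by (simp add: mult_nonpos_nonneg)
  then have s: "(r$1)\<^sup>2 + (r$2)\<^sup>2 \<le> 0"
    using orthogonal_H2_bound[OF assms(1,2)] by linarith
  then have "r$1 = 0" "r$2 = 0"
    by (auto simp: sum_power2_le_zero_iff)
  moreover from this have "r$3 = 0"
    using assms(1,2) by (auto simp: H2_def lorentz_def)
  ultimately show ?thesis
    by (simp add: vec_eq_iff forall_3)
qed

lemma lorentz_H2_neg:
  assumes "x \<in> H2" "y \<in> H2"
  shows "lorentz x y < 0"
proof -
  have 1: "(x$3)\<^sup>2 = 1 + (x$1)\<^sup>2 + (x$2)\<^sup>2" "(y$3)\<^sup>2 = 1 + (y$1)\<^sup>2 + (y$2)\<^sup>2"
    and 2: "x$3 > 0" "y$3 > 0"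
    using assms by (auto simp: H2_def lorentz_def power2_eq_square algebra_simps)
  have "(x$3 * y$3)\<^sup>2 - (x$1 * y$1 + x$2 * y$2)\<^sup>2 =
      1 + (x$1)\<^sup>2 + (x$2)\<^sup>2 + (y$1)\<^sup>2 + (y$2)\<^sup>2 + (x$1 * y$2 - x$2 * y$1)\<^sup>2"
    unfolding power_mult_distrib 1 by (simp add: power2_eq_square algebra_simps)
  then have "(x$1 * y$1 + x$2 * y$2)\<^sup>2 < (x$3 * y$3)\<^sup>2"
    using zero_le_power2[of "x$1"] zero_le_power2[of "x$2"] zero_le_power2[of "y$1"]
      zero_le_power2[of "y$2"] zero_le_power2[of "x$1 * y$2 - x$2 * y$1"] by linarith
  then have "x$1 * y$1 + x$2 * y$2 < x$3 * y$3"
    by (rule power_less_imp_less_base) (use 2 in simp)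
  then show ?thesis by (simp add: lorentz_def)
qed

lemma lorentz_H2_le:
  assumes "x \<in> H2" "y \<in> H2"
  shows "lorentz x y \<le> -1"
proof -
  \<comment> \<open>This vector is the projection of y to the tangent plane at x; that its norm is
    non-negative is the reversed Cauchy-Schwarz inequality.\<close>
  have "0 \<le> lorentz (y + lorentz x y *\<^sub>R x) (y + lorentz x y *\<^sub>R x)"
    using assms by (intro orthogonal_H2_nonneg[of x]) (auto simp: lorentz_simps H2_lorentz)
  also have "\<dots> = (lorentz x y)\<^sup>2 - 1"
    using assms by (simp add: lorentz_simps H2_lorentz lorentz_commute[of y x] power2_eq_square)
  finally have "1\<^sup>2 \<le> (- lorentz x y)\<^sup>2" by simp
  then have "1 \<le> - lorentz x y"
    by (rule power2_le_imp_le) (use lorentz_H2_neg[OF assms] in auto)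
  then show ?thesis by simp
qed

lemma lorentz_H2_eq:
  assumes "x \<in> H2" "y \<in> H2" "lorentz x y \<ge> -1"
  shows "x = y"
proof -
  have e: "lorentz x y = -1"
    using lorentz_H2_le[OF assms(1,2)] assms(3) by simp
  have "y - x = 0"
    by (rule orthogonal_H2_eq_0[OF assms(1)])
      (use assms e in \<open>auto simp: lorentz_simps H2_lorentz lorentz_commute[of y x]\<close>)
  then show ?thesis by simp
qed

text \<open>A vector of norm -1 lies on one of two sheets, and the sign of its product with a point
  of \<open>H2\<close> tells which.\<close>

lemma H2_memI:
  assumes "x \<in> H2" "lorentz y y = -1" "lorentz x y < 0"
  shows "y \<in> H2"
proof (rule ccontr)
  assume "y \<notin> H2"
  with assms(2) have "y$3 \<le> 0" by (simp add: H2_def)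
  moreover have "y$3 \<noteq> 0"
  proof
    assume "y$3 = 0"
    with assms(2) have "y$1 * y$1 + y$2 * y$2 = -1" by (simp add: lorentz_def)
    then show False using zero_le_square[of "y$1"] zero_le_square[of "y$2"] by linarith
  qed
  ultimately have "- y \<in> H2"
    using assms(2) by (simp add: H2_def lorentz_simps)
  from lorentz_H2_neg[OF assms(1) this] assms(3) show False
    by (simp add: lorentz_simps)
qed

text \<open>Orthogonality to t and n reduces the Gram determinant of t, n, r to
  \<open>lorentz r r\<close>, which is therefore not positive; orthogonality to x then leaves only r
  = 0.\<close>

lemma orthonormal_frame_eq_0:
  assumes "x \<in> H2" "lorentz t t = 1" "lorentz n n = 1" "lorentz t n = 0"
    and "lorentz r x = 0" "lorentz r t = 0" "lorentz r n = 0"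
  shows "r = 0"
proof (rule orthogonal_H2_eq_0[OF assms(1)])
  have "(lorentz r (lcross t n))\<^sup>2 = - lorentz r r"
    unfolding gram_det by (simp add: assms lorentz_commute[of n r] lorentz_commute[of t r])
  then show "lorentz r r \<le> 0" using zero_le_power2[of "lorentz r (lcross t n)"] by linarith
qed (simp add: assms lorentz_commute[of x r])

section \<open>Curves of constant curvature\<close>

text \<open>\<open>cs\<close>, \<open>sn\<close> and \<open>vs\<close> are cosine, sine and versine of a plane of constant curvature \<open>- \<mu>\<close>.\<close>

lemma exists_trig_functions:
  fixes \<mu> :: real
  obtains cs sn vs :: "real \<Rightarrow> real" where
    "\<And>s. (cs has_real_derivative \<mu> * sn s) (at s)"
    "\<And>s. (sn has_real_derivative cs s) (at s)"
    "\<And>s. (vs has_real_derivative sn s) (at s)"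
    "sn 0 = 0" "vs 0 = 0"
    "\<And>s. cs s = 1 + \<mu> * vs s"
    "\<And>s. (sn s)\<^sup>2 = 2 * vs s + \<mu> * (vs s)\<^sup>2"
    "\<And>s. vs s \<ge> 0"
    "\<And>b u. u \<ge> 0 \<Longrightarrow> b\<^sup>2 = 2 * u + \<mu> * u\<^sup>2 \<Longrightarrow> \<exists>s. sn s = b \<and> vs s = u"
proof -
  \<comment> \<open>For \<open>\<mu> \<ge> 0\<close> the quadratic
    \<open>2 * u + \<mu> * u\<^sup>2\<close> increases on \<open>u \<ge> 0\<close>, so the value of
    \<open>sn\<close> determines that of \<open>vs\<close>. For \<open>\<mu> < 0\<close> this fails,
    and an angle is found from both values together.\<close>
  have uniq: "u = v" if "u \<ge> 0" "v \<ge> 0" "2 * u + \<mu> * u\<^sup>2 = 2 * v + \<mu> * v\<^sup>2" "\<mu> \<ge> 0" for u v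
  proof -
    have "(u - v) * (2 + \<mu> * (u + v)) = 0"
      using that(3) by (simp add: power2_eq_square algebra_simps)
    moreover have "2 + \<mu> * (u + v) > 0"
      using that by (simp add: add_pos_nonneg)
    ultimately show ?thesis by simp
  qed
  consider "\<mu> = 0" | "\<mu> > 0" | "\<mu> < 0" by linarith
  then show thesis
  proof cases
    case 1
    show thesis
    proof (rule that[of "\<lambda>_. 1" "\<lambda>s. s" "\<lambda>s. s\<^sup>2 / 2"])
      show "\<exists>s. s = b \<and> s\<^sup>2 / 2 = u" if "b\<^sup>2 = 2 * u + \<mu> * u\<^sup>2" for b u
        using that 1 by simp
    qed (auto intro!: derivative_eq_intros simp: 1)
  next
    case 2
    define w where "w = sqrt \<mu>"
    have w: "w > 0" "\<mu> = w\<^sup>2" using 2 by (auto simp: w_def)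
    define sn where "sn = (\<lambda>s. sinh (w * s) / w)"
    define vs where "vs = (\<lambda>s. (cosh (w * s) - 1) / w\<^sup>2)"
    have sq: "(sn s)\<^sup>2 = 2 * vs s + \<mu> * (vs s)\<^sup>2" for s
    proof -
      have "2 * vs s + \<mu> * (vs s)\<^sup>2 = ((cosh (w * s))\<^sup>2 - 1) / w\<^sup>2"
        using w by (simp add: vs_def power2_eq_square field_simps)
      then show ?thesis by (simp add: sn_def cosh_square_eq power_divide)
    qed
    have nonneg: "vs s \<ge> 0" for s by (simp add: vs_def cosh_real_ge_1)
    show thesis
    proof (rule that[of "\<lambda>s. cosh (w * s)" sn vs])
      fix b u :: real assume u: "u \<ge> 0" "b\<^sup>2 = 2 * u + \<mu> * u\<^sup>2"
      have "sn (arsinh (w * b) / w) = b" using w by (simp add: sn_def)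
      moreover from this have "vs (arsinh (w * b) / w) = u"
        using sq[of "arsinh (w * b) / w"] u(2) 2 by (intro uniq[OF nonneg u(1)]) simp_all
      ultimately show "\<exists>s. sn s = b \<and> vs s = u" by blast
    next
      fix s show "((\<lambda>s. cosh (w * s)) has_real_derivative \<mu> * sn s) (at s)"
        "(sn has_real_derivative cosh (w * s)) (at s)" "(vs has_real_derivative sn s) (at s)"
        unfolding sn_def vs_def using w
        by (auto intro!: derivative_eq_intros simp: power2_eq_square field_simps)
    qed (use w sq nonneg in \<open>auto simp: sn_def vs_def\<close>)
  next
    case 3
    define w where "w = sqrt (- \<mu>)"
    have w: "w > 0" "\<mu> = - w\<^sup>2" using 3 by (auto simp: w_def)
    define sn where "sn = (\<lambda>s. sin (w * s) / w)"
    define vs where "vs = (\<lambda>s. (1 - cos (w * s)) / w\<^sup>2)"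
    have sq: "(sn s)\<^sup>2 = 2 * vs s + \<mu> * (vs s)\<^sup>2" for s
    proof -
      have "2 * vs s + \<mu> * (vs s)\<^sup>2 = (1 - (cos (w * s))\<^sup>2) / w\<^sup>2"
        using w by (simp add: vs_def power2_eq_square field_simps)
      then show ?thesis by (simp add: sn_def sin_squared_eq power_divide)
    qed
    show thesis
    proof (rule that[of "\<lambda>s. cos (w * s)" sn vs])
      fix b u :: real assume u: "u \<ge> 0" "b\<^sup>2 = 2 * u + \<mu> * u\<^sup>2"
      have "(1 - w\<^sup>2 * u)\<^sup>2 + (w * b)\<^sup>2 = 1"
        unfolding power_mult_distrib u w by (simp add: power2_eq_square algebra_simps)
      then obtain t where "1 - w\<^sup>2 * u = cos t" "w * b = sin t"
        using sincos_total_2pi by metis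
      then have "sn (t / w) = b" "vs (t / w) = u"
        using w by (auto simp: sn_def vs_def field_simps)
      then show "\<exists>s. sn s = b \<and> vs s = u" by blast
    next
      fix s show "((\<lambda>s. cos (w * s)) has_real_derivative \<mu> * sn s) (at s)"
        "(sn has_real_derivative cos (w * s)) (at s)" "(vs has_real_derivative sn s) (at s)"
        unfolding sn_def vs_def using w
        by (auto intro!: derivative_eq_intros simp: power2_eq_square field_simps)
    qed (use w sq in \<open>auto simp: sn_def vs_def\<close>)
  qed
qed

text \<open>In the frame x, t, n with \<open>n = M - \<kappa> *\<^sub>R x\<close>, a point y of the
  plane is determined by \<open>a = - lorentz y x\<close> and \<open>b = lorentz y t\<close>. Lying
  on \<open>H2\<close> then means that b and a - 1 satisfy the identity linking \<open>sn\<close>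
  and \<open>vs\<close>, and \<open>surj\<close> supplies the parameter.\<close>

lemma constant_curvature_range:
  assumes x: "x \<in> H2" and t: "lorentz t t = 1" "lorentz x t = 0"
    and M: "lorentz x M = - \<kappa>" "lorentz t M = 0" "lorentz M M = 1 - \<kappa>\<^sup>2"
    and vs: "\<And>s. (sn s)\<^sup>2 = 2 * vs s + (1 - \<kappa>\<^sup>2) * (vs s)\<^sup>2" "\<And>s. vs s \<ge> 0"
    and surj: "\<And>b u. u \<ge> 0 \<Longrightarrow> b\<^sup>2 = 2 * u + (1 - \<kappa>\<^sup>2) * u\<^sup>2 \<Longrightarrow> \<exists>s. sn s = b \<and> vs s = u"
  shows "range (\<lambda>s. (1 + (1 - \<kappa>\<^sup>2) * vs s) *\<^sub>R x + sn s *\<^sub>R t + (\<kappa> * vs s) *\<^sub>R M) =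
    {y \<in> H2. lorentz y M = - \<kappa>}"
proof -
  define n where "n = M - \<kappa> *\<^sub>R x"
  have n: "lorentz n n = 1" "lorentz x n = 0" "lorentz t n = 0"
    using x t M by (simp_all add: n_def lorentz_simps H2_lorentz lorentz_commute[of M x]
        lorentz_commute[of t x] power2_eq_square)
  have M_eq: "M = \<kappa> *\<^sub>R x + n" by (simp add: n_def)
  have curve: "(1 + (1 - \<kappa>\<^sup>2) * vs s) *\<^sub>R x + sn s *\<^sub>R t + (\<kappa> * vs s) *\<^sub>R M =
      (1 + vs s) *\<^sub>R x + sn s *\<^sub>R t + (\<kappa> * vs s) *\<^sub>R n" for s
    by (simp add: M_eq vec_eq_iff power2_eq_square algebra_simps)
  note frame = t n H2_lorentz[OF x] lorentz_commute[of t x] lorentz_commute[of n x] lorentz_commute[of n t]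
  show ?thesis
    unfolding curve
  proof (intro equalityI subsetI)
    fix y assume "y \<in> range (\<lambda>s. (1 + vs s) *\<^sub>R x + sn s *\<^sub>R t + (\<kappa> * vs s) *\<^sub>R n)"
    then obtain s where y: "y = (1 + vs s) *\<^sub>R x + sn s *\<^sub>R t + (\<kappa> * vs s) *\<^sub>R n" by blast
    have "lorentz y y = - (1 + vs s)\<^sup>2 + (sn s)\<^sup>2 + (\<kappa> * vs s)\<^sup>2"
      unfolding y by (simp add: lorentz_simps frame power2_eq_square algebra_simps)
    also have "\<dots> = -1" unfolding vs(1) by (simp add: power2_eq_square algebra_simps)
    finally have "y \<in> H2"
      using vs(2)[of s] by (intro H2_memI[OF x]) (simp_all add: y lorentz_simps frame)
    moreover have "lorentz y M = - \<kappa>"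
      unfolding y M_eq by (simp add: lorentz_simps frame algebra_simps)
    ultimately show "y \<in> {y \<in> H2. lorentz y M = - \<kappa>}" by simp
  next
    fix y assume "y \<in> {y \<in> H2. lorentz y M = - \<kappa>}"
    then have y: "y \<in> H2" "lorentz y M = - \<kappa>" by auto
    define a b where "a = - lorentz y x" and "b = lorentz y t"
    have c: "lorentz y n = \<kappa> * (a - 1)"
      using y by (simp add: n_def a_def lorentz_simps algebra_simps)
    have "y - (a *\<^sub>R x + b *\<^sub>R t + (\<kappa> * (a - 1)) *\<^sub>R n) = 0"
      by (rule orthonormal_frame_eq_0[OF x t(1) n(1) n(3)])
        (simp_all add: lorentz_simps frame c, simp_all add: a_def b_def)
    then have y_eq: "y = a *\<^sub>R x + b *\<^sub>R t + (\<kappa> * (a - 1)) *\<^sub>R n" by simp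
    have "-1 = lorentz y y" using y by (simp add: H2_lorentz)
    also have "\<dots> = - a\<^sup>2 + b\<^sup>2 + (\<kappa> * (a - 1))\<^sup>2"
      unfolding y_eq by (simp add: lorentz_simps frame power2_eq_square algebra_simps)
    finally have "b\<^sup>2 = 2 * (a - 1) + (1 - \<kappa>\<^sup>2) * (a - 1)\<^sup>2"
      by (simp add: power2_eq_square algebra_simps)
    moreover have "a - 1 \<ge> 0" using lorentz_H2_le[OF y(1) x] by (simp add: a_def)
    ultimately obtain s where s: "sn s = b" "vs s = a - 1" using surj by blast
    have "y = (1 + vs s) *\<^sub>R x + sn s *\<^sub>R t + (\<kappa> * vs s) *\<^sub>R n"
      unfolding s using y_eq by simp
    then show "y \<in> range (\<lambda>s. (1 + vs s) *\<^sub>R x + sn s *\<^sub>R t + (\<kappa> * vs s) *\<^sub>R n)" by blast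
  qed
qed

lemma unit_speed_curve_derivative:
  assumes "unit_speed_curve \<gamma>"
  shows "(\<gamma> has_vector_derivative velocity \<gamma> s) (at s)"
    and "(velocity \<gamma> has_vector_derivative velocity (velocity \<gamma>) s) (at s)"
proof -
  have d: "(f has_vector_derivative velocity f s) (at s)" if "f differentiable at s" for f
    using that by (simp add: velocity_def vector_derivative_works)
  have "\<gamma> differentiable at s" "velocity \<gamma> differentiable at s"
    using assms by (auto simp: unit_speed_curve_def)
  then show "(\<gamma> has_vector_derivative velocity \<gamma> s) (at s)"
    "(velocity \<gamma> has_vector_derivative velocity (velocity \<gamma>) s) (at s)"
    by (auto intro: d)
qed

lemma zero_derivative_constant:
  fixes f :: "real \<Rightarrow> 'a::real_normed_vector"
  assumes "\<And>s. (f has_vector_derivative 0) (at s)"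
  shows "f s = f 0"
  using has_vector_derivative_zero_constant[of UNIV f] assms by (metis UNIV_I convex_UNIV)

lemma lorentz_constant_derivative:
  assumes "\<And>s. (f has_vector_derivative f' s) (at s)" "\<And>s. (g has_vector_derivative g' s) (at s)"
    and "\<And>s. lorentz (f s) (g s) = c"
  shows "lorentz (f s) (g' s) + lorentz (f' s) (g s) = 0"
proof -
  have "((\<lambda>s. lorentz (f s) (g s)) has_vector_derivative
      lorentz (f s) (g' s) + lorentz (f' s) (g s)) (at s)"
    by (rule lorentz.has_vector_derivative[OF assms(1,2)])
  moreover have "((\<lambda>s. lorentz (f s) (g s)) has_vector_derivative 0) (at s)"
    by (simp add: assms(3))
  ultimately show ?thesis
    by (rule vector_derivative_unique_at)
qed

text \<open>
  The vector \<open>M = \<kappa> \<gamma> + n\<close>, with \<open>n\<close> the unit normal of the curve \<open>\<gamma>\<close>, is constant by the Frenet equations,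
  and it is a normal vector of the plane containing the curve.
\<close>

lemma constant_curvature_curve_plane:
  assumes "constant_curvature_curve C"
  obtains M \<kappa> where "C = {y \<in> H2. lorentz y M = - \<kappa>}" "C \<noteq> {}" "lorentz M M = 1 - \<kappa>\<^sup>2"
proof -
  obtain \<gamma> \<kappa> where \<gamma>: "unit_speed_curve \<gamma>" and curv: "\<And>s. geodesic_curvature \<gamma> s = \<kappa>"
    and C: "C = range \<gamma>"
    using assms by (auto simp: constant_curvature_curve_def)
  define t where "t = velocity \<gamma>"
  define a where "a = velocity t"
  note d\<gamma> = unit_speed_curve_derivative(1)[OF \<gamma>, folded t_def]
  note dt = unit_speed_curve_derivative(2)[OF \<gamma>, folded t_def, folded a_def]
  have H: "\<gamma> s \<in> H2" for s using \<gamma> by (simp add: unit_speed_curve_def)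
  have tt: "lorentz (t s) (t s) = 1" for s using \<gamma> by (simp add: unit_speed_curve_def t_def)
  have gg: "lorentz (\<gamma> s) (\<gamma> s) = -1" for s using H H2_lorentz by blast
  have gt: "lorentz (\<gamma> s) (t s) = 0" for s
    using lorentz_constant_derivative[OF d\<gamma> d\<gamma> gg, of s] by (simp add: lorentz_commute[of "t s"])
  have ta: "lorentz (t s) (a s) = 0" for s
    using lorentz_constant_derivative[OF dt dt tt, of s] by (simp add: lorentz_commute[of "a s"])
  have ga: "lorentz (\<gamma> s) (a s) = -1" for s
    using lorentz_constant_derivative[OF d\<gamma> dt gt, of s] by (simp add: tt)
  define n where "n s = lcross (\<gamma> s) (t s)" for s
  have nn: "lorentz (n s) (n s) = 1" for s
    by (simp add: n_def lorentz_lcross_lcross gg tt gt)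
  have gn: "lorentz (\<gamma> s) (n s) = 0" and tn: "lorentz (t s) (n s) = 0" for s
    by (simp_all add: n_def)
  have an: "lorentz (a s) (n s) = \<kappa>" for s
    using curv[of s] unfolding geodesic_curvature_def det_eq_lorentz_lcross
    by (simp add: n_def a_def t_def)
  note frame = gg tt gt gn tn nn ga ta an lorentz_commute[of "t _" "\<gamma> _"] lorentz_commute[of "n _" "\<gamma> _"]
    lorentz_commute[of "n _" "t _"] lorentz_commute[of "a _" "\<gamma> _"] lorentz_commute[of "a _" "t _"]
  have a: "a s = \<gamma> s + \<kappa> *\<^sub>R n s" for s
  proof -
    have "a s - (\<gamma> s + \<kappa> *\<^sub>R n s) = 0"
      by (rule orthonormal_frame_eq_0[OF H[of s] tt[of s] nn[of s] tn]) (simp_all add: lorentz_simps frame)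
    then show ?thesis by simp
  qed
  define M where "M s = \<kappa> *\<^sub>R \<gamma> s + n s" for s
  have "(M has_vector_derivative 0) (at s)" for s
  proof -
    have "(n has_vector_derivative lcross (\<gamma> s) (a s) + lcross (t s) (t s)) (at s)"
      unfolding n_def by (rule lcross.has_vector_derivative[OF d\<gamma> dt])
    moreover have "lcross (\<gamma> s) (a s) = - (\<kappa> *\<^sub>R t s)"
      unfolding a n_def by (simp add: lcross.add_right lcross.scaleR_right lcross_lcross gg gt)
    ultimately have "(n has_vector_derivative - (\<kappa> *\<^sub>R t s)) (at s)" by simp
    from has_vector_derivative_add[OF has_vector_derivative_scaleR[OF DERIV_const d\<gamma>] this, of \<kappa>]
    show ?thesis by (simp add: M_def[abs_def])
  qed
  then have M: "M s = M 0" for s by (rule zero_derivative_constant)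
  \<comment> \<open>The acceleration is \<mu> times the position plus \<kappa> times the constant
    \<open>M 0\<close>. A circle has \<open>\<mu> < 0\<close>, a horocycle \<open>\<mu> = 0\<close>;
    \<open>vs\<close> stands for \<open>(cs - 1) / \<mu>\<close> and covers the case
    \<open>\<mu> = 0\<close> uniformly.\<close>
  define \<mu> where "\<mu> = 1 - \<kappa>\<^sup>2"
  have a': "a s = \<mu> *\<^sub>R \<gamma> s + \<kappa> *\<^sub>R M 0" for s
    unfolding a M[of s, symmetric] by (simp add: M_def \<mu>_def power2_eq_square algebra_simps)
  obtain cs sn vs where
    d: "\<And>s. (cs has_real_derivative \<mu> * sn s) (at s)"
      "\<And>s. (sn has_real_derivative cs s) (at s)" "\<And>s. (vs has_real_derivative sn s) (at s)"
    and 0: "sn 0 = 0" "vs 0 = 0" and cs: "\<And>s. cs s = 1 + \<mu> * vs s"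
    and sq: "\<And>s. (sn s)\<^sup>2 = 2 * vs s + \<mu> * (vs s)\<^sup>2" "\<And>s. vs s \<ge> 0"
    and surj: "\<And>b u. u \<ge> 0 \<Longrightarrow> b\<^sup>2 = 2 * u + \<mu> * u\<^sup>2 \<Longrightarrow> \<exists>s. sn s = b \<and> vs s = u"
    by (rule exists_trig_functions[of \<mu>]) (rule that; assumption)
  \<comment> \<open>Running the equation backwards from s to 0 should return the initial data. That
    this combination and the next one are constant is checked by differentiation, so no uniqueness
    theorem for differential equations is invoked.\<close>
  have "cs s *\<^sub>R \<gamma> s - sn s *\<^sub>R t s + (\<kappa> * vs s) *\<^sub>R M 0 = \<gamma> 0" for s
  proof -
    have "((\<lambda>s. cs s *\<^sub>R \<gamma> s - sn s *\<^sub>R t s + (\<kappa> * vs s) *\<^sub>R M 0) has_vector_derivative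
      (cs s *\<^sub>R t s + (\<mu> * sn s) *\<^sub>R \<gamma> s) - (sn s *\<^sub>R a s + cs s *\<^sub>R t s) + (\<kappa> * sn s) *\<^sub>R M 0) (at s)" for s
      by (rule derivative_eq_intros d d\<gamma> dt refl DERIV_cmult | simp)+
    then have "((\<lambda>s. cs s *\<^sub>R \<gamma> s - sn s *\<^sub>R t s + (\<kappa> * vs s) *\<^sub>R M 0) has_vector_derivative 0) (at s)" for s
      unfolding a' by (simp add: algebra_simps)
    from zero_derivative_constant[OF this, of s] show ?thesis
      by (simp add: 0 cs)
  qed
  note e1 = this
  have "cs s *\<^sub>R t s - (\<mu> * sn s) *\<^sub>R \<gamma> s - (\<kappa> * sn s) *\<^sub>R M 0 = t 0" for s
  proof -
    have "((\<lambda>s. cs s *\<^sub>R t s - (\<mu> * sn s) *\<^sub>R \<gamma> s - (\<kappa> * sn s) *\<^sub>R M 0) has_vector_derivative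
      (cs s *\<^sub>R a s + (\<mu> * sn s) *\<^sub>R t s) - ((\<mu> * sn s) *\<^sub>R t s + (\<mu> * cs s) *\<^sub>R \<gamma> s) - (\<kappa> * cs s) *\<^sub>R M 0) (at s)" for s
      by (rule derivative_eq_intros d d\<gamma> dt refl DERIV_cmult | simp)+
    then have "((\<lambda>s. cs s *\<^sub>R t s - (\<mu> * sn s) *\<^sub>R \<gamma> s - (\<kappa> * sn s) *\<^sub>R M 0) has_vector_derivative 0) (at s)" for s
      unfolding a' by (simp add: algebra_simps)
    from zero_derivative_constant[OF this, of s] show ?thesis
      by (simp add: 0 cs)
  qed
  note e2 = this
  \<comment> \<open>The two conserved combinations form a linear system for position and velocity at
    s, with determinant \<open>cs s * cs s - \<mu> * (sn s * sn s) = 1\<close>.\<close>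
  have \<gamma>_eq: "\<gamma> s = (1 + \<mu> * vs s) *\<^sub>R \<gamma> 0 + sn s *\<^sub>R t 0 + (\<kappa> * vs s) *\<^sub>R M 0" for s
  proof -
    have 1: "cs s * cs s - \<mu> * (sn s * sn s) = 1"
      using sq(1)[of s] by (simp add: cs power2_eq_square algebra_simps)
    have 2: "cs s * vs s - sn s * sn s + vs s = 0"
      using sq(1)[of s] by (simp add: cs power2_eq_square algebra_simps)
    have "cs s *\<^sub>R \<gamma> 0 + sn s *\<^sub>R t 0 =
        (cs s * cs s - \<mu> * (sn s * sn s)) *\<^sub>R \<gamma> s + (\<kappa> * (cs s * vs s - sn s * sn s)) *\<^sub>R M 0"
      unfolding e1[of s, symmetric] e2[of s, symmetric]
      by (simp add: algebra_simps)
    also have "\<dots> = \<gamma> s - (\<kappa> * vs s) *\<^sub>R M 0"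
      unfolding 1 using 2 by (simp add: eq_neg_iff_add_eq_0[symmetric])
    finally show ?thesis by (simp add: cs)
  qed
  have M0: "lorentz (\<gamma> 0) (M 0) = - \<kappa>" "lorentz (t 0) (M 0) = 0" "lorentz (M 0) (M 0) = 1 - \<kappa>\<^sup>2"
    by (simp_all add: M_def lorentz_simps frame power2_eq_square)
  have "range \<gamma> = range (\<lambda>s. (1 + \<mu> * vs s) *\<^sub>R \<gamma> 0 + sn s *\<^sub>R t 0 + (\<kappa> * vs s) *\<^sub>R M 0)"
    by (rule image_cong[OF HOL.refl \<gamma>_eq])
  also have "\<dots> = {y \<in> H2. lorentz y (M 0) = - \<kappa>}"
    unfolding \<mu>_def
    by (rule constant_curvature_range[OF H[of 0] tt[of 0] gt[of 0] M0]) (use sq surj in \<open>auto simp: \<mu>_def\<close>)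
  finally have "C = {y \<in> H2. lorentz y (M 0) = - \<kappa>}" by (simp add: C)
  then show thesis using C M0(3) by (intro that) auto
qed

text \<open>The solution of the curvature equation through x is written down, and its speed and
  curvature are computed. Circles, horocycles and equidistant curves need no separate
  treatment.\<close>

lemma constant_curvature_curve_of_plane:
  assumes x: "x \<in> H2" and M: "lorentz x M = - \<kappa>" "lorentz M M = 1 - \<kappa>\<^sup>2"
  shows "constant_curvature_curve {y \<in> H2. lorentz y M = - \<kappa>}"
proof -
  define \<mu> where "\<mu> = 1 - \<kappa>\<^sup>2"
  \<comment> \<open>The velocity must be tangent to \<open>H2\<close> and to the plane; its norm is
    \<open>\<kappa>\<^sup>2 + (1 - \<kappa>\<^sup>2)\<close>. This order of the factors gives
    curvature \<kappa> and not -\<kappa>.\<close>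
  define t where "t = lcross M x"
  have t: "lorentz t t = 1" "lorentz x t = 0" "lorentz t M = 0"
    by (simp_all add: t_def lorentz_lcross_lcross M H2_lorentz[OF x] lorentz_commute[of M x])
  obtain cs sn vs where
    d: "\<And>s. (cs has_real_derivative \<mu> * sn s) (at s)"
      "\<And>s. (sn has_real_derivative cs s) (at s)" "\<And>s. (vs has_real_derivative sn s) (at s)"
    and cs: "\<And>s. cs s = 1 + \<mu> * vs s"
    and sq: "\<And>s. (sn s)\<^sup>2 = 2 * vs s + \<mu> * (vs s)\<^sup>2" "\<And>s. vs s \<ge> 0"
    and surj: "\<And>b u. u \<ge> 0 \<Longrightarrow> b\<^sup>2 = 2 * u + \<mu> * u\<^sup>2 \<Longrightarrow> \<exists>s. sn s = b \<and> vs s = u"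
    by (rule exists_trig_functions[of \<mu>]) (rule that; assumption)
  define \<gamma> where "\<gamma> s = cs s *\<^sub>R x + sn s *\<^sub>R t + (\<kappa> * vs s) *\<^sub>R M" for s
  define v where "v s = (\<mu> * sn s) *\<^sub>R x + cs s *\<^sub>R t + (\<kappa> * sn s) *\<^sub>R M" for s
  define a where "a s = (\<mu> * cs s) *\<^sub>R x + (\<mu> * sn s) *\<^sub>R t + (\<kappa> * cs s) *\<^sub>R M" for s
  have d\<gamma>: "(\<gamma> has_vector_derivative v s) (at s)" for s
    unfolding \<gamma>_def[abs_def] v_def by (rule derivative_eq_intros d refl DERIV_cmult | simp)+
  have dv: "(v has_vector_derivative a s) (at s)" for s
    unfolding v_def[abs_def] a_def by (rule derivative_eq_intros d refl DERIV_cmult | simp)+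
  have v: "velocity \<gamma> = v" using d\<gamma> by (auto simp: velocity_def vector_derivative_at)
  have a: "velocity v = a" using dv by (auto simp: velocity_def vector_derivative_at)
  have range: "range \<gamma> = {y \<in> H2. lorentz y M = - \<kappa>}"
    unfolding \<gamma>_def[abs_def] cs unfolding \<mu>_def
    by (rule constant_curvature_range[OF x t(1,2) M(1) t(3) M(2)]) (use sq surj in \<open>auto simp: \<mu>_def\<close>)
  have H: "\<gamma> s \<in> H2" "lorentz (\<gamma> s) M = - \<kappa>" for s
    using range by auto
  have id: "(cs s)\<^sup>2 - \<mu> * (sn s)\<^sup>2 = 1" for s
    unfolding sq cs by (simp add: power2_eq_square algebra_simps)
  note frame = t M H2_lorentz[OF x] lorentz_commute[of t x] lorentz_commute[of M x] lorentz_commute[of M t]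
  have vv: "lorentz (v s) (v s) = 1" for s
  proof -
    have "lorentz (v s) (v s) = (cs s)\<^sup>2 - (\<mu>\<^sup>2 + 2 * \<mu> * \<kappa>\<^sup>2 - \<kappa>\<^sup>2 * (1 - \<kappa>\<^sup>2)) * (sn s)\<^sup>2"
      by (simp add: v_def lorentz_simps frame power2_eq_square algebra_simps)
    also have "\<mu>\<^sup>2 + 2 * \<mu> * \<kappa>\<^sup>2 - \<kappa>\<^sup>2 * (1 - \<kappa>\<^sup>2) = \<mu>"
      by (simp add: \<mu>_def power2_eq_square algebra_simps)
    finally show ?thesis using id by simp
  qed
  have curv: "geodesic_curvature \<gamma> s = \<kappa>" for s
  proof -
    have e: "a s = \<mu> *\<^sub>R \<gamma> s + \<kappa> *\<^sub>R M"
      by (simp add: a_def \<gamma>_def cs vec_eq_iff algebra_simps)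
    have "geodesic_curvature \<gamma> s = lorentz (a s) (lcross (\<gamma> s) (v s))"
      unfolding geodesic_curvature_def det_eq_lorentz_lcross v a ..
    also have "\<dots> = \<kappa> * lorentz M (lcross (\<gamma> s) (v s))"
      unfolding e by (simp add: lorentz_simps)
    also have "lcross (\<gamma> s) (v s) = ((cs s)\<^sup>2 - \<mu> * (sn s)\<^sup>2) *\<^sub>R lcross x t
        + (\<kappa> * (cs s * sn s - \<mu> * vs s * sn s)) *\<^sub>R lcross x M + (\<kappa> * ((sn s)\<^sup>2 - vs s * cs s)) *\<^sub>R lcross t M"
    proof -
      have anti: "lcross t x = - lcross x t" "lcross M x = - lcross x M" "lcross M t = - lcross t M"
        by (simp_all add: lcross_def vec_eq_iff forall_3 vector_3)
      show ?thesis
        unfolding \<gamma>_def v_def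
        by (simp add: lcross.add_left lcross.add_right lcross.scaleR_left lcross.scaleR_right anti
            power2_eq_square algebra_simps)
    qed
    also have "\<kappa> * lorentz M \<dots> = \<kappa> * lorentz M (lcross x t)"
      by (simp add: id lorentz_simps)
    also have "lcross x t = M - \<kappa> *\<^sub>R x"
      unfolding t_def lcross_lcross by (simp add: frame)
    also have "lorentz M (M - \<kappa> *\<^sub>R x) = 1"
      by (simp add: lorentz_simps frame power2_eq_square)
    finally show ?thesis by simp
  qed
  have "unit_speed_curve \<gamma>"
    unfolding unit_speed_curve_def v using H vv differentiableI_vector[OF d\<gamma>]
      differentiableI_vector[OF dv] by simp
  then show ?thesis
    unfolding constant_curvature_curve_def using curv range by blast
qed

section \<open>Hyperbolic segments\<close>

text \<open>The addition theorem for cosh, which is injective on non-negative arguments. It makes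
  betweenness an algebraic condition on Lorentz products.\<close>

lemma arcosh_add_eq_iff:
  fixes u v w :: real
  assumes "u \<ge> 1" "v \<ge> 1" "w \<ge> 1"
  shows "arcosh u + arcosh v = arcosh w \<longleftrightarrow> w - u * v = sqrt (u\<^sup>2 - 1) * sqrt (v\<^sup>2 - 1)"
proof -
  have c: "cosh (arcosh u + arcosh v) = u * v + sqrt (u\<^sup>2 - 1) * sqrt (v\<^sup>2 - 1)"
    using assms by (simp add: cosh_add sinh_arcosh_real)
  have nn: "arcosh u + arcosh v \<ge> 0" using assms by (simp add: add_nonneg_nonneg)
  have "arcosh u + arcosh v = arcosh w \<longleftrightarrow> cosh (arcosh u + arcosh v) = cosh (arcosh w)"
    using arcosh_cosh_real[OF nn] assms by (metis cosh_arcosh_real)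
  then show ?thesis using assms unfolding c by auto
qed

lemma hdist_add_eq_iff:
  assumes "x \<in> H2" "y \<in> H2" "z \<in> H2"
  shows "hdist x z + hdist z y = hdist x y \<longleftrightarrow>
    - lorentz x y - lorentz x z * lorentz y z = sqrt ((lorentz x z)\<^sup>2 - 1) * sqrt ((lorentz y z)\<^sup>2 - 1)"
  unfolding hdist_def
  using lorentz_H2_le[OF assms(1,2)] lorentz_H2_le[OF assms(1,3)] lorentz_H2_le[OF assms(3,2)]
  by (subst arcosh_add_eq_iff) (auto simp: lorentz_commute[of z y])

text \<open>Equality in the triangle inequality makes the Gram determinant of x, y, z vanish. The
  part of z orthogonal to x and y then has norm 0, and being tangent at x it is zero.\<close>

lemma hseg_imp_combination:
  assumes H: "x \<in> H2" "y \<in> H2" and z: "z \<in> hseg x y"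
  obtains a b where "a \<ge> 0" "b \<ge> 0" "z = a *\<^sub>R x + b *\<^sub>R y"
proof -
  have zH: "z \<in> H2" and d: "hdist x z + hdist z y = hdist x y"
    using z by (auto simp: hseg_def)
  define A B C where "A = - lorentz x z" and "B = - lorentz y z" and "C = - lorentz x y"
  have ge: "A \<ge> 1" "B \<ge> 1" "C \<ge> 1"
    using lorentz_H2_le H zH by (force simp: A_def B_def C_def)+
  have e: "C - A * B = sqrt (A\<^sup>2 - 1) * sqrt (B\<^sup>2 - 1)"
    using hdist_add_eq_iff[OF H zH] d by (simp add: A_def B_def C_def)
  have sq: "A\<^sup>2 - 1 \<ge> 0" "B\<^sup>2 - 1 \<ge> 0" using ge by (simp_all add: power2_eq_square mult_ge1_I)
  have CAB: "C \<ge> A * B" using e sq by (smt (verit) mult_nonneg_nonneg real_sqrt_ge_0_iff)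
  have e2: "(C - A * B)\<^sup>2 = (A\<^sup>2 - 1) * (B\<^sup>2 - 1)"
    unfolding e using sq by (simp add: power_mult_distrib)
  note frame = H2_lorentz[OF H(1)] H2_lorentz[OF H(2)] H2_lorentz[OF zH]
    lorentz_commute[of z x] lorentz_commute[of z y] lorentz_commute[of y x]
  have l: "lorentz x z = - A" "lorentz y z = - B" "lorentz x y = - C"
    by (simp_all add: A_def B_def C_def)
  show thesis
  proof (cases "C = 1")
    case True
    have "A * 1 \<le> A * B" using ge by (intro mult_left_mono) auto
    then have "A = 1" using CAB True ge by linarith
    then have "x = z" using lorentz_H2_eq[OF H(1) zH] l by simp
    then show thesis using that[of 1 0] by simp
  next
    case False
    define K where "K = C\<^sup>2 - 1"
    have K: "K > 0" using False ge by (simp add: K_def power2_eq_square less_1_mult)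
    \<comment> \<open>The solution of the two equations obtained by pairing
      \<open>z = a *\<^sub>R x + b *\<^sub>R y\<close> with x and y. Up to sign K is their
      determinant, non-zero unless x and y coincide.\<close>
    define a b where "a = (B * C - A) / K" and "b = (A * C - B) / K"
    have aK: "a * K = B * C - A" "b * K = A * C - B" using K by (simp_all add: a_def b_def)
    have BB: "1 \<le> B * B" "1 \<le> A * A" using ge by (auto intro: mult_ge1_I)
    have "A \<le> B * C"
    proof -
      have "A * 1 \<le> A * (B * B)" using ge BB by (intro mult_left_mono) auto
      also have "\<dots> = B * (A * B)" by simp
      also have "\<dots> \<le> B * C" using CAB ge by (intro mult_left_mono) auto
      finally show ?thesis by simp
    qed
    then have a0: "a \<ge> 0" using K by (simp add: a_def)
    have "B \<le> A * C"
    proof -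
      have "B * 1 \<le> B * (A * A)" using ge BB by (intro mult_left_mono) auto
      also have "\<dots> = A * (A * B)" by simp
      also have "\<dots> \<le> A * C" using CAB ge by (intro mult_left_mono) auto
      finally show ?thesis by simp
    qed
    then have b0: "b \<ge> 0" using K by (simp add: b_def)
    have ab: "a + b * C = A" "a * C + b = B"
    proof -
      have "(a + b * C) * K = a * K + b * K * C" "(a * C + b) * K = a * K * C + b * K"
        by (simp_all add: algebra_simps)
      then have "(a + b * C) * K = A * K" "(a * C + b) * K = B * K"
        unfolding aK by (simp_all add: K_def power2_eq_square algebra_simps)
      then show "a + b * C = A" "a * C + b = B" using K by auto
    qed
    define r where "r = z - a *\<^sub>R x - b *\<^sub>R y"
    have rx: "lorentz x r = 0" and ry: "lorentz y r = 0"
      using ab by (simp_all add: r_def lorentz_simps frame l)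
    have "lorentz r r = lorentz (z - a *\<^sub>R x - b *\<^sub>R y) r" by (simp only: r_def)
    also have "\<dots> = lorentz z r" using rx ry by (simp add: lorentz.diff_left lorentz.scaleR_left)
    also have "\<dots> = - 1 + a * A + b * B"
      by (simp add: r_def lorentz_simps frame l)
    also have "\<dots> = 0"
    proof -
      have "(- 1 + a * A + b * B) * K = - K + a * K * A + b * K * B" by (simp add: algebra_simps)
      also have "\<dots> = (A\<^sup>2 - 1) * (B\<^sup>2 - 1) - (C - A * B)\<^sup>2"
        unfolding aK by (simp add: K_def power2_eq_square algebra_simps)
      finally show ?thesis using e2 K by simp
    qed
    finally have "r = 0" using orthogonal_H2_eq_0[OF H(1) rx] by simp
    then show thesis using that[OF a0 b0] by (simp add: r_def algebra_simps)
  qed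
qed

lemma combination_imp_hseg:
  assumes H: "x \<in> H2" "y \<in> H2" "z \<in> H2" and z: "z = a *\<^sub>R x + b *\<^sub>R y" and ab: "a \<ge> 0" "b \<ge> 0"
  shows "z \<in> hseg x y"
proof -
  define C where "C = - lorentz x y"
  have C: "C \<ge> 1" using lorentz_H2_le[OF H(1,2)] by (simp add: C_def)
  have lC: "lorentz x y = - C" by (simp add: C_def)
  note frame = H2_lorentz[OF H(1)] H2_lorentz[OF H(2)] lorentz_commute[of y x] lC
  have 1: "lorentz x z = - (a + b * C)" "lorentz y z = - (a * C + b)"
    by (simp_all add: z lorentz_simps frame)
  have "lorentz z z = - (a\<^sup>2 + b\<^sup>2 + 2 * a * b * C)"
    by (simp add: z lorentz_simps frame power2_eq_square algebra_simps)
  then have n: "a\<^sup>2 + b\<^sup>2 + 2 * a * b * C = 1" using H2_lorentz[OF H(3)] by simp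
  have K: "C\<^sup>2 - 1 \<ge> 0" using C by (simp add: power2_eq_square mult_ge1_I)
  have "(lorentz x z)\<^sup>2 - 1 = b\<^sup>2 * (C\<^sup>2 - 1)" "(lorentz y z)\<^sup>2 - 1 = a\<^sup>2 * (C\<^sup>2 - 1)"
  proof -
    have "(a + b * C)\<^sup>2 = b\<^sup>2 * (C\<^sup>2 - 1) + (a\<^sup>2 + b\<^sup>2 + 2 * a * b * C)"
      "(a * C + b)\<^sup>2 = a\<^sup>2 * (C\<^sup>2 - 1) + (a\<^sup>2 + b\<^sup>2 + 2 * a * b * C)"
      by (simp_all add: power2_eq_square algebra_simps)
    then show "(lorentz x z)\<^sup>2 - 1 = b\<^sup>2 * (C\<^sup>2 - 1)" "(lorentz y z)\<^sup>2 - 1 = a\<^sup>2 * (C\<^sup>2 - 1)"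
      unfolding 1 n power2_minus by simp_all
  qed
  then have "sqrt ((lorentz x z)\<^sup>2 - 1) * sqrt ((lorentz y z)\<^sup>2 - 1) = a * b * (C\<^sup>2 - 1)"
    using ab K by (simp add: real_sqrt_mult)
  also have "\<dots> = C * (a\<^sup>2 + b\<^sup>2 + 2 * a * b * C) - (a + b * C) * (a * C + b)"
    by (simp add: power2_eq_square algebra_simps)
  also have "\<dots> = - lorentz x y - lorentz x z * lorentz y z"
    unfolding n 1 lC by (simp add: algebra_simps)
  finally show ?thesis
    using H hdist_add_eq_iff[OF H] by (simp add: hseg_def)
qed

lemma hseg_iff:
  assumes "x \<in> H2" "y \<in> H2"
  shows "z \<in> hseg x y \<longleftrightarrow> z \<in> H2 \<and> (\<exists>a\<ge>0. \<exists>b\<ge>0. z = a *\<^sub>R x + b *\<^sub>R y)"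
  using hseg_imp_combination[OF assms] combination_imp_hseg[OF assms] assms
  by (metis (no_types, lifting) hseg_def mem_Collect_eq)

lemma endpoints_in_hseg: "x \<in> H2 \<Longrightarrow> y \<in> H2 \<Longrightarrow> x \<in> hseg x y \<and> y \<in> hseg x y"
  by (simp add: hseg_def hdist_def H2_lorentz)

text \<open>Radial projection of the future cone to the hyperboloid. It carries straight chords to
  geodesic segments, which is how Euclidean arguments enter below.\<close>

definition hnormalize :: "real^3 \<Rightarrow> real^3" where
  "hnormalize x = (1 / sqrt (- lorentz x x)) *\<^sub>R x"

text \<open>The reversed triangle inequality: a sum of future timelike vectors is at least as long
  as their lengths added.\<close>

lemma lorentz_combination_le:
  assumes "x \<in> H2" "y \<in> H2" "a \<ge> 0" "b \<ge> 0"
  shows "lorentz (a *\<^sub>R x + b *\<^sub>R y) (a *\<^sub>R x + b *\<^sub>R y) \<le> - (a + b)\<^sup>2"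
proof -
  have "lorentz (a *\<^sub>R x + b *\<^sub>R y) (a *\<^sub>R x + b *\<^sub>R y) = - a\<^sup>2 - b\<^sup>2 + 2 * (a * b) * lorentz x y"
    using assms by (simp add: lorentz_simps H2_lorentz lorentz_commute[of y x]
          power2_eq_square algebra_simps)
  moreover have "(a * b) * lorentz x y \<le> (a * b) * (-1)"
    using assms lorentz_H2_le by (intro mult_left_mono) auto
  ultimately show ?thesis by (simp add: power2_eq_square algebra_simps)
qed

lemma combination_H2_le_1:
  assumes "x \<in> H2" "y \<in> H2" "a \<ge> 0" "b \<ge> 0" "a *\<^sub>R x + b *\<^sub>R y \<in> H2"
  shows "a + b \<le> 1"
  using lorentz_combination_le[OF assms(1-4)] H2_lorentz[OF assms(5)] power2_le_imp_le[of "a + b" 1]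
  by simp

lemma combination_timelike:
  assumes "x \<in> H2" "y \<in> H2" "a \<ge> 0" "b \<ge> 0" "a + b > 0"
  shows "lorentz (a *\<^sub>R x + b *\<^sub>R y) (a *\<^sub>R x + b *\<^sub>R y) < 0" "(a *\<^sub>R x + b *\<^sub>R y)$3 > 0"
proof -
  have "(a + b)\<^sup>2 > 0" using assms by simp
  then show "lorentz (a *\<^sub>R x + b *\<^sub>R y) (a *\<^sub>R x + b *\<^sub>R y) < 0"
    using lorentz_combination_le[OF assms(1-4)] by linarith
  have "x$3 > 0" "y$3 > 0" using assms by (auto simp: H2_def)
  moreover have "a > 0 \<or> b > 0" using assms(5) by linarith
  ultimately show "(a *\<^sub>R x + b *\<^sub>R y)$3 > 0"
    using assms(3,4) by (auto simp: add_pos_nonneg add_nonneg_pos)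
qed

lemma hnormalize_in_H2: "lorentz x x < 0 \<Longrightarrow> x$3 > 0 \<Longrightarrow> hnormalize x \<in> H2"
  by (simp add: hnormalize_def H2_def lorentz_simps)

lemma scaleR_hnormalize: "lorentz x x < 0 \<Longrightarrow> x = sqrt (- lorentz x x) *\<^sub>R hnormalize x"
  by (simp add: hnormalize_def)

lemma hnormalize_in_hseg:
  assumes "x \<in> H2" "y \<in> H2" "a \<ge> 0" "b \<ge> 0" "a + b > 0"
  shows "hnormalize (a *\<^sub>R x + b *\<^sub>R y) \<in> hseg x y"
proof -
  let ?z = "a *\<^sub>R x + b *\<^sub>R y"
  note t = combination_timelike[OF assms]
  have "hnormalize ?z = (a / sqrt (- lorentz ?z ?z)) *\<^sub>R x + (b / sqrt (- lorentz ?z ?z)) *\<^sub>R y"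
    by (simp add: hnormalize_def scaleR_add_right)
  moreover have "a / sqrt (- lorentz ?z ?z) \<ge> 0" "b / sqrt (- lorentz ?z ?z) \<ge> 0"
    using t assms by auto
  ultimately show ?thesis
    using hnormalize_in_H2[OF t] assms combination_imp_hseg by metis
qed

text \<open>As \<open>hconvex\<close> includes being a subset of \<open>H2\<close>, it passes to
  intersections only of non-empty families. The assumption puts \<open>H2\<close> itself into the
  family that defines the hull.\<close>

lemma hconvex_hull_hconvex:
  assumes "A \<subseteq> H2"
  shows "hconvex (hconvex hull A)"
proof -
  have H: "hconvex H2" by (auto simp: hconvex_def hseg_def)
  show ?thesis
    unfolding hconvex_def[of "hconvex hull A"]
  proof (intro conjI ballI)
    show "hconvex hull A \<subseteq> H2" using H assms by (simp add: hull_minimal)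
    show "hseg x y \<subseteq> hconvex hull A" if "x \<in> hconvex hull A" "y \<in> hconvex hull A" for x y
    proof
      fix z assume z: "z \<in> hseg x y"
      have "z \<in> t" if t: "hconvex t" "A \<subseteq> t" for t
      proof -
        have "x \<in> t" "y \<in> t"
          using hull_minimal[of A t hconvex] t \<open>x \<in> _\<close> \<open>y \<in> _\<close> by auto
        then show ?thesis using t(1) z unfolding hconvex_def by blast
      qed
      then show "z \<in> hconvex hull A" by (simp add: hull_def)
    qed
  qed
qed

lemma nondegenerate:
  assumes H: "x \<in> H2" "y \<in> H2" "z \<in> H2" and nc: "\<not> hcollinear x y z"
  shows "lorentz x (lcross y z) \<noteq> 0"
proof
  assume 0: "lorentz x (lcross y z) = 0"
  have "y \<noteq> z" using nc endpoints_in_hseg[OF H(1,2)] by (auto simp: hcollinear_def)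
  then have yz: "lorentz y z < -1"
    using lorentz_H2_eq[OF H(2,3)] lorentz_H2_le[OF H(2,3)] by fastforce
  \<comment> \<open>The normal of the span of y and z does not lie in that span, so the dependence
    given by Cramer's rule has a non-zero coefficient A at x.\<close>
  define w where "w = lcross y z"
  define A where "A = lorentz w (lcross y z)"
  have A: "A > 0"
  proof -
    have "1\<^sup>2 < (- lorentz y z)\<^sup>2" using yz by (intro power_strict_mono) auto
    then show ?thesis by (simp add: A_def w_def lorentz_lcross_lcross H2_lorentz H)
  qed
  have "A *\<^sub>R x + lorentz w (lcross z x) *\<^sub>R y + lorentz w (lcross x y) *\<^sub>R z = 0"
    using cramer[of x y z w] 0 by (simp add: A_def)
  then have "x = (- lorentz w (lcross z x) / A) *\<^sub>R y + (- lorentz w (lcross x y) / A) *\<^sub>R z"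
    using A by (simp add: vec_eq_iff field_simps) (smt (verit))
  then obtain b c where x: "x = b *\<^sub>R y + c *\<^sub>R z" by blast
  have "-1 = b * lorentz x y + c * lorentz x z"
    using H2_lorentz[OF H(1)] by (subst (asm) (2) x) (simp add: lorentz_simps)
  moreover have "lorentz x y < 0" "lorentz x z < 0" using lorentz_H2_neg H by auto
  \<comment> \<open>Products of points of \<open>H2\<close> are negative, so two non-positive
    coefficients could not give -1. The signs that remain say which of the three points is the
    middle one.\<close>
  ultimately have "b > 0 \<or> c > 0"
    by (smt (verit) mult_nonpos_nonpos)
  then consider "b \<ge> 0" "c \<ge> 0" | "b > 0" "c < 0" | "b < 0" "c > 0" by linarith
  then have "hcollinear x y z"
  proof cases
    case 1
    then show ?thesis using combination_imp_hseg[OF H(2,3,1) x] by (simp add: hcollinear_def)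
  next
    case 2
    have "y = (1 / b) *\<^sub>R x + (- c / b) *\<^sub>R z" using 2 by (simp add: x scaleR_add_right)
    from combination_imp_hseg[OF H(1,3,2) this] 2 show ?thesis
      by (simp add: hcollinear_def divide_le_0_iff)
  next
    case 3
    have "z = (1 / c) *\<^sub>R x + (- b / c) *\<^sub>R y" using 3 by (simp add: x scaleR_add_right)
    from combination_imp_hseg[OF H(1,2,3) this] 3 show ?thesis
      by (simp add: hcollinear_def divide_le_0_iff)
  qed
  then show False using nc by simp
qed

section \<open>Circumcircles and circum-balls\<close>

lemma lorentz_eq_0I:
  assumes "\<And>w. lorentz w r = 0"
  shows "r = 0"
proof -
  have "lorentz (vector [r$1, r$2, - r$3]) r = 0" by (rule assms)
  then have "r \<bullet> r = 0" by (simp add: lorentz_def inner_vec_def sum_3)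
  then show ?thesis by simp
qed

lemma orthogonal_basis_eq_0:
  assumes "lorentz x (lcross y z) \<noteq> 0" "lorentz x r = 0" "lorentz y r = 0" "lorentz z r = 0"
  shows "r = 0"
proof (rule lorentz_eq_0I)
  fix w
  have "lorentz (lorentz x (lcross y z) *\<^sub>R w) r = 0"
    unfolding cramer[of x y z w] by (simp add: lorentz_simps assms)
  then show "lorentz w r = 0" using assms(1) by (simp add: lorentz_simps)
qed

text \<open>n is the sum of the basis dual to x, y, z. The level 1 is available because the plane
  through three independent points misses the origin.\<close>

lemma affine_normal_exists:
  assumes "lorentz x (lcross y z) \<noteq> 0"
  obtains n where "lorentz x n = 1" "lorentz y n = 1" "lorentz z n = 1"
proof -
  define D where "D = lorentz x (lcross y z)"
  have D: "lorentz y (lcross z x) = D" "lorentz z (lcross x y) = D"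
    by (simp_all add: D_def lorentz_def lcross_def algebra_simps)
  have "D \<noteq> 0" using assms by (simp add: D_def)
  then show thesis
    by (intro that[of "(1 / D) *\<^sub>R (lcross y z + lcross z x + lcross x y)"])
      (simp_all add: lorentz_simps D flip: D_def)
qed

lemma basis_expansion:
  assumes "lorentz x (lcross y z) \<noteq> 0"
  obtains \<alpha> \<beta> \<gamma> where "w = \<alpha> *\<^sub>R x + \<beta> *\<^sub>R y + \<gamma> *\<^sub>R z"
    "\<alpha> = lorentz w (lcross y z) / lorentz x (lcross y z)"
proof -
  let ?D = "lorentz x (lcross y z)"
  have "w = (1 / ?D) *\<^sub>R (?D *\<^sub>R w)" using assms by simp
  also have "\<dots> = (lorentz w (lcross y z) / ?D) *\<^sub>R x + (lorentz w (lcross z x) / ?D) *\<^sub>R y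
      + (lorentz w (lcross x y) / ?D) *\<^sub>R z"
    unfolding cramer[of x y z w] by (simp add: scaleR_add_right)
  finally show thesis using that by blast
qed

text \<open>n + x is tangent at x and has norm \<open>lorentz n n + 1\<close>. Were that not
  positive, n + x would be 0, and the plane would touch \<open>H2\<close> at x and contain no second
  point of it.\<close>

lemma affine_normal_bound:
  assumes "x \<in> H2" "y \<in> H2" "x \<noteq> y" "lorentz x n = 1" "lorentz y n = 1"
  shows "lorentz n n > -1"
proof (rule ccontr)
  assume "\<not> ?thesis"
  then have "n + x = 0"
    using assms by (intro orthogonal_H2_eq_0[of x])
      (auto simp: lorentz_simps H2_lorentz lorentz_commute[of n x])
  then have "n = - x" by (simp add: eq_neg_iff_add_eq_0)
  then have "x = y" using assms by (intro lorentz_H2_eq) (auto simp: lorentz_simps lorentz_commute[of y x])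
  then show False using assms by simp
qed

lemma hyperbolic_triangle_basis:
  assumes "hyperbolic_triangle v"
  shows "v k \<in> H2" "lorentz (v 1) (lcross (v 2) (v 3)) \<noteq> 0"
  using assms nondegenerate[of "v 1" "v 2" "v 3"] by (auto simp: hyperbolic_triangle_def)

text \<open>For uniqueness, the plane of a competing curve contains the three vertices, so its
  normal M is a multiple of n. The factor is not zero: \<open>\<kappa> = 0\<close> would give M = 0,
  against \<open>lorentz M M = 1 - \<kappa>\<^sup>2\<close>. In particular no geodesic passes
  through the vertices.\<close>

lemma circumcircle_eq:
  assumes v: "hyperbolic_triangle v" and n: "\<And>k. lorentz (v k) n = 1"
  shows "circumcircle v = {x \<in> H2. lorentz x n = 1}" "lorentz n n > -1"
proof -
  note H = hyperbolic_triangle_basis[OF v]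
  have "v 1 \<noteq> v 2" using H(2) by auto
  then show bound: "lorentz n n > -1" using affine_normal_bound[of "v 1" "v 2"] H n by blast
  \<comment> \<open>The factor for which \<open>- \<kappa> *\<^sub>R n\<close> meets the
    normalisation \<open>lorentz M M = 1 - \<kappa>\<^sup>2\<close> of the normal of a constant
    curvature curve.\<close>
  define \<kappa> where "\<kappa> = 1 / sqrt (1 + lorentz n n)"
  have \<kappa>: "\<kappa> \<noteq> 0" "\<kappa>\<^sup>2 * (1 + lorentz n n) = 1" using bound by (simp_all add: \<kappa>_def power_divide)
  have "constant_curvature_curve {y \<in> H2. lorentz y (- \<kappa> *\<^sub>R n) = - \<kappa>}"
    using \<kappa>(2) n[of 1]
    by (intro constant_curvature_curve_of_plane[OF H(1)[of 1]])
      (auto simp: lorentz_simps power2_eq_square algebra_simps)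
  then have ex: "constant_curvature_curve {x \<in> H2. lorentz x n = 1}"
    using \<kappa>(1) by (simp add: lorentz_simps)
  show "circumcircle v = {x \<in> H2. lorentz x n = 1}"
    unfolding circumcircle_def
  proof (rule the_equality)
    show "constant_curvature_curve {x \<in> H2. lorentz x n = 1} \<and> range v \<subseteq> {x \<in> H2. lorentz x n = 1}"
      using ex n H(1) by auto
  next
    fix C assume C: "constant_curvature_curve C \<and> range v \<subseteq> C"
    obtain M \<kappa> where M: "C = {y \<in> H2. lorentz y M = - \<kappa>}" "lorentz M M = 1 - \<kappa>\<^sup>2"
      using C by (blast elim: constant_curvature_curve_plane)
    have "lorentz (v k) M = - \<kappa>" for k using C M by auto
    then have "M + \<kappa> *\<^sub>R n = 0"
      by (intro orthogonal_basis_eq_0[OF H(2)]) (simp_all add: lorentz_simps n)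
    then have M_eq: "M = - \<kappa> *\<^sub>R n" by (simp add: eq_neg_iff_add_eq_0)
    then have "\<kappa> \<noteq> 0" using M(2) by (auto simp: lorentz.zero_left)
    then show "C = {x \<in> H2. lorentz x n = 1}" unfolding M M_eq by (simp add: lorentz_simps)
  qed
qed

section \<open>Half-spaces of the hyperboloid and uniqueness of the circum-ball\<close>

lemma continuous_on_lorentz [continuous_intros]:
  "continuous_on A f \<Longrightarrow> continuous_on A g \<Longrightarrow> continuous_on A (\<lambda>x. lorentz (f x) (g x))"
  by (rule lorentz.continuous_on)

text \<open>The coefficients of a point of a segment add up to at most 1, and the level of the plane
  is positive. This is why the side with the origin is the convex one.\<close>

lemma half_space_hconvex: "hconvex {x \<in> H2. lorentz x n \<le> 1}"
  unfolding hconvex_def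
proof (intro conjI ballI subsetI)
  fix x y z assume xy: "x \<in> {x \<in> H2. lorentz x n \<le> 1}" "y \<in> {x \<in> H2. lorentz x n \<le> 1}"
    and z: "z \<in> hseg x y"
  then obtain a b where ab: "a \<ge> 0" "b \<ge> 0" "z = a *\<^sub>R x + b *\<^sub>R y" "z \<in> H2"
    using hseg_iff by auto
  have "lorentz z n = a * lorentz x n + b * lorentz y n" by (simp add: ab lorentz_simps)
  also have "\<dots> \<le> a * 1 + b * 1" using ab xy by (intro add_mono mult_left_mono) auto
  also have "\<dots> \<le> 1" using combination_H2_le_1[of x y a b] ab xy by auto
  finally show "z \<in> {x \<in> H2. lorentz x n \<le> 1}" using ab by simp
qed auto

text \<open>Two points are joined by the projection of their chord. Projecting divides by a length
  that is at least 1, so the value stays below 1.\<close>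

lemma open_half_space_connected:
  "connectedin (top_of_set H2) {x \<in> H2. lorentz x n < 1}"
proof -
  have "connected {x \<in> H2. lorentz x n < 1}"
    unfolding connected_iff_connected_component
  proof (intro ballI)
    fix x y assume "x \<in> {x \<in> H2. lorentz x n < 1}" "y \<in> {x \<in> H2. lorentz x n < 1}"
    then have x: "x \<in> H2" "lorentz x n < 1" and y: "y \<in> H2" "lorentz y n < 1" by auto
    define f where "f t = (1 - t) *\<^sub>R x + t *\<^sub>R y" for t :: real
    have tl: "lorentz (f t) (f t) < 0" "f t $ 3 > 0" "lorentz (f t) (f t) \<le> -1" if "t \<in> {0..1}" for t
      using that combination_timelike[OF x(1) y(1), of "1 - t" t]
        lorentz_combination_le[OF x(1) y(1), of "1 - t" t] by (auto simp: f_def)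
    have "connected ((\<lambda>t. hnormalize (f t)) ` {0..1})"
    proof (rule connected_continuous_image)
      show "continuous_on {0..1} (\<lambda>t. hnormalize (f t))"
        unfolding hnormalize_def
      proof (intro continuous_intros ballI)
        show "continuous_on {0..1} f" "continuous_on {0..1} f" "continuous_on {0..1} f"
          unfolding f_def by (intro continuous_intros)+
        show "sqrt (- lorentz (f t) (f t)) \<noteq> 0" if "t \<in> {0..1}" for t
          using tl[OF that] by simp
      qed
    qed simp
    moreover have "(\<lambda>t. hnormalize (f t)) ` {0..1} \<subseteq> {x \<in> H2. lorentz x n < 1}"
    proof (intro image_subsetI)
      fix t :: real assume t: "t \<in> {0..1}"
      have "lorentz (f t) n < 1"
      proof -
        have "lorentz (f t) n = (1 - t) * lorentz x n + t * lorentz y n"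
          by (simp add: f_def lorentz_simps)
        also have "\<dots> < 1" using t x y by (intro convex_bound_lt) auto
        finally show ?thesis .
      qed
      also have "1 \<le> sqrt (- lorentz (f t) (f t))" using tl(3)[OF t] by simp
      finally have "lorentz (hnormalize (f t)) n < 1"
        using tl(1)[OF t] by (simp add: hnormalize_def lorentz_simps)
      then show "hnormalize (f t) \<in> {x \<in> H2. lorentz x n < 1}"
        using hnormalize_in_H2 tl(1,2)[OF t] by simp
    qed
    moreover have "x = hnormalize (f 0)" "y = hnormalize (f 1)"
      using x y by (simp_all add: f_def hnormalize_def H2_lorentz)
    then have "x \<in> (\<lambda>t. hnormalize (f t)) ` {0..1}" "y \<in> (\<lambda>t. hnormalize (f t)) ` {0..1}"
      by (auto intro: image_eqI[of _ _ 0] image_eqI[of _ _ 1])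
    ultimately show "connected_component {x \<in> H2. lorentz x n < 1} x y"
      unfolding connected_component_def by blast
  qed
  then show ?thesis by (auto simp: connectedin_subtopology)
qed

lemma openin_half_space: "openin (top_of_set H2) {x \<in> H2. lorentz x n < 1}"
proof -
  have "open {x. lorentz x n < 1}" by (intro open_Collect_less continuous_intros)
  then show ?thesis by (auto simp: openin_open)
qed

lemma closedin_half_space: "closedin (top_of_set H2) {x \<in> H2. lorentz x n \<le> 1}"
proof -
  have "closed {x. lorentz x n \<le> 1}" by (intro closed_Collect_le continuous_intros)
  then show ?thesis by (auto simp: closedin_closed)
qed

lemma interior_half_space:
  assumes "lorentz n n > -1"
  shows "top_of_set H2 interior_of {x \<in> H2. lorentz x n \<le> 1} = {x \<in> H2. lorentz x n < 1}"
proof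
  show "{x \<in> H2. lorentz x n < 1} \<subseteq> top_of_set H2 interior_of {x \<in> H2. lorentz x n \<le> 1}"
    by (rule interior_of_maximal[OF _ openin_half_space]) auto
  show "top_of_set H2 interior_of {x \<in> H2. lorentz x n \<le> 1} \<subseteq> {x \<in> H2. lorentz x n < 1}"
  proof
    fix x assume x: "x \<in> top_of_set H2 interior_of {x \<in> H2. lorentz x n \<le> 1}"
    then have xH: "x \<in> H2" "lorentz x n \<le> 1"
      using interior_of_subset[of "top_of_set H2" "{x \<in> H2. lorentz x n \<le> 1}"] by auto
    obtain U where U: "open U" "x \<in> U" "H2 \<inter> U \<subseteq> {x \<in> H2. lorentz x n \<le> 1}"
      using x by (auto simp: interior_of_def openin_open)
    show "x \<in> {x \<in> H2. lorentz x n < 1}"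
    proof (rule ccontr)
      assume "x \<notin> {x \<in> H2. lorentz x n < 1}"
      with xH have xn: "lorentz x n = 1" by auto
      define w where "w = sqrt (1 + lorentz n n)"
      have w: "w > 0" "1 + lorentz n n = w * w" using assms by (simp_all add: w_def)
      \<comment> \<open>u is the component of n tangent at x, and c is the geodesic leaving x in
        this direction. Along it the value is \<open>cosh s + w * sinh s\<close>, which exceeds 1 at
        once.\<close>
      define u where "u = n + x"
      define c where "c s = cosh s *\<^sub>R x + (sinh s / w) *\<^sub>R u" for s
      have l: "lorentz x u = 0" "lorentz u x = 0" "lorentz u u = w * w"
          "lorentz u n = w * w"
        using xn w(2) H2_lorentz[OF xH(1)] by (simp_all add: lorentz_simps u_def lorentz_commute[of n x])
      have cc: "lorentz (c s) (c s) = - 1" for s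
      proof -
        have "lorentz (c s) (c s) = - (cosh s)\<^sup>2 + (sinh s)\<^sup>2"
          using w(1) by (simp add: c_def lorentz_simps l H2_lorentz[OF xH(1)] power2_eq_square)
        then show ?thesis by (simp add: cosh_square_eq)
      qed
      have "lorentz x (c s) = - cosh s" for s
        by (simp add: c_def lorentz_simps l H2_lorentz[OF xH(1)])
      then have cH: "c s \<in> H2" for s
        using cc by (intro H2_memI[OF xH(1)]) (simp_all add: cosh_real_pos)
      have cn: "lorentz (c s) n = cosh s + w * sinh s" for s
        using w(1) by (simp add: c_def lorentz_simps xn l)
      have "(c \<longlongrightarrow> c 0) (at_right 0)"
        unfolding c_def using w(1) by (intro tendsto_intros) auto
      then have "eventually (\<lambda>s. c s \<in> U) (at_right 0)"
        by (rule topological_tendstoD) (use U in \<open>simp_all add: c_def\<close>)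
      then have "eventually (\<lambda>s. s > 0 \<and> c s \<in> U) (at_right 0)"
        by (intro eventually_conj eventually_at_right_less)
      then obtain s where s: "s > 0" "c s \<in> U"
        using eventually_happens[of _ "at_right (0::real)"] by (auto simp: trivial_limit_at_right_real)
      then have "cosh s + w * sinh s \<le> 1" using U(3) cH[of s] cn[of s] by auto
      moreover have "cosh s \<ge> 1" "w * sinh s > 0" using s(1) w(1) by (simp_all add: cosh_real_ge_1)
      ultimately show False by linarith
    qed
  qed
qed

text \<open>The witness is the hyperbolic midpoint: p + q has value 2 against n, but Lorentz length
  more than 2.\<close>

lemma hseg_meets_open_half_space:
  assumes p: "p \<in> H2" "lorentz p n = 1" and q: "q \<in> H2" "lorentz q n = 1" and pq: "p \<noteq> q"
  obtains m where "m \<in> hseg p q" "lorentz m n < 1"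
proof -
  have "lorentz p q < -1"
    using lorentz_H2_eq[OF p(1) q(1)] lorentz_H2_le[OF p(1) q(1)] pq by fastforce
  then have "sqrt (2\<^sup>2) < sqrt (- lorentz (p + q) (p + q))"
    using p q by (intro real_sqrt_less_mono) (simp add: lorentz_simps H2_lorentz lorentz_commute[of q p])
  moreover have "lorentz (hnormalize (p + q)) n = 2 / sqrt (- lorentz (p + q) (p + q))"
    by (simp add: hnormalize_def lorentz.scaleR_left lorentz.add_left[of p q n] p q)
  ultimately have "lorentz (hnormalize (p + q)) n < 1"
    by (simp only: divide_less_eq_1 real_sqrt_abs) linarith
  moreover have "hnormalize (p + q) \<in> hseg p q"
    using hnormalize_in_hseg[OF p(1) q(1), of 1 1] by simp
  ultimately show thesis using that by blast
qed

text \<open>The two boundary points p and q fix the side: convexity puts a point of the open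
  half-space into B. As that half-space is connected and avoids the frontier, all of it lies in
  B.\<close>

lemma circumball_unique:
  assumes n: "lorentz n n > -1"
    and p: "p \<in> H2" "lorentz p n = 1" and q: "q \<in> H2" "lorentz q n = 1" and pq: "p \<noteq> q"
    and B: "hconvex B" "closedin (top_of_set H2) B"
      "top_of_set H2 frontier_of B = {x \<in> H2. lorentz x n = 1}"
  shows "B = {x \<in> H2. lorentz x n \<le> 1}"
proof -
  have BH: "B \<subseteq> H2" using B(1) by (simp add: hconvex_def)
  have fr: "top_of_set H2 frontier_of B = B - top_of_set H2 interior_of B"
    using B(2) by (simp add: frontier_of_def closure_of_closedin)
  have E: "{x \<in> H2. lorentz x n = 1} \<subseteq> B" using B(3) fr by auto
  have U: "{x \<in> H2. lorentz x n < 1} \<subseteq> B"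
  proof (rule ccontr)
    assume nU: "\<not> ?thesis"
    obtain m where m: "m \<in> hseg p q" "lorentz m n < 1"
      using hseg_meets_open_half_space[OF p q pq] by blast
    have "m \<in> B" using m(1) B(1) E p q unfolding hconvex_def by (metis (mono_tags, lifting) mem_Collect_eq subsetD)
    then have "{x \<in> H2. lorentz x n < 1} \<inter> B \<noteq> {}" using m(2) BH by auto
    moreover have "{x \<in> H2. lorentz x n < 1} - B \<noteq> {}" using nU by auto
    ultimately have "{x \<in> H2. lorentz x n < 1} \<inter> top_of_set H2 frontier_of B \<noteq> {}"
      by (intro connectedin_Int_frontier_of open_half_space_connected)
    then show False unfolding B(3) by auto
  qed
  \<comment> \<open>If \<open>B\<close> had a point beyond the plane, some boundary point would be interior to the convex cone over \<open>B\<close>.\<close>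
  define K where "K = {c *\<^sub>R x | c x. c > 0 \<and> x \<in> B}"
  have "convex K"
  proof (rule convexI)
    fix x y u v assume "x \<in> K" "y \<in> K" and uv: "0 \<le> u" "0 \<le> v" "u + v = (1::real)"
    then obtain c d x' y' where x: "x = c *\<^sub>R x'" "c > 0" "x' \<in> B" and y: "y = d *\<^sub>R y'" "d > 0" "y' \<in> B"
      by (auto simp: K_def)
    have pos: "u * c \<ge> 0" "v * d \<ge> 0" "u * c + v * d > 0"
    proof -
      show "u * c \<ge> 0" "v * d \<ge> 0" using uv x y by auto
      have "u > 0 \<or> v > 0" using uv by linarith
      then show "u * c + v * d > 0" using uv x y by (auto simp: add_pos_nonneg add_nonneg_pos)
    qed
    let ?z = "(u * c) *\<^sub>R x' + (v * d) *\<^sub>R y'"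
    have xy: "x' \<in> H2" "y' \<in> H2" using x y BH by auto
    have "hnormalize ?z \<in> B"
      using hnormalize_in_hseg[OF xy pos] B(1) x(3) y(3) by (auto simp: hconvex_def)
    moreover note combination_timelike(1)[OF xy pos]
    moreover from this have "?z = sqrt (- lorentz ?z ?z) *\<^sub>R hnormalize ?z" by (rule scaleR_hnormalize)
    ultimately have "?z \<in> K" unfolding K_def by force
    then show "u *\<^sub>R x + v *\<^sub>R y \<in> K" by (simp add: x y)
  qed
  have KB: "x \<in> B" if "x \<in> K" "x \<in> H2" for x
  proof -
    obtain c x' where x: "x = c *\<^sub>R x'" "c > 0" "x' \<in> B" using \<open>x \<in> K\<close> by (auto simp: K_def)
    have "c * c = 1" using H2_lorentz[OF \<open>x \<in> H2\<close>] H2_lorentz[of x'] x BH by (auto simp: lorentz_simps)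
    then have "c = 1" using x(2) by (metis abs_of_pos abs_mult_self_eq mult.right_neutral power2_eq_square power2_eq_iff_nonneg less_imp_le zero_le_one)
    then show ?thesis using x by simp
  qed
  \<comment> \<open>\<open>?W\<close> is the open cone over the open half-space; its last condition
    is the homogeneous form of the inequality.\<close>
  have Kint: "y \<in> interior K" if y: "y \<in> H2" "lorentz y n < 1" for y
  proof (rule interiorI)
    let ?W = "{x. lorentz x x < 0} \<inter> {x::real^3. x$3 > 0} \<inter> {x. lorentz x n < sqrt (- lorentz x x)}"
    show "open ?W" by (intro open_Int open_Collect_less continuous_intros)
    show "y \<in> ?W" using y by (auto simp: H2_def)
    show "?W \<subseteq> K"
    proof
      fix x assume x: "x \<in> ?W"
      have "lorentz (hnormalize x) n < 1" using x by (simp add: hnormalize_def lorentz_simps)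
      then have "hnormalize x \<in> B" using U hnormalize_in_H2[of x] x by auto
      moreover have "x = sqrt (- lorentz x x) *\<^sub>R hnormalize x" using x by (intro scaleR_hnormalize) auto
      ultimately show "x \<in> K" using x unfolding K_def by force
    qed
  qed
  have "lorentz z n \<le> 1" if z: "z \<in> B" for z
  proof (rule ccontr)
    assume zn: "\<not> lorentz z n \<le> 1"
    have zH: "z \<in> H2" using z BH by auto
    obtain y where y: "y \<in> H2" "lorentz y n < 1"
      using hseg_meets_open_half_space[OF p q pq] by (auto simp: hseg_def)
    define f where "f t = z - t *\<^sub>R (z - y)" for t :: real
    have f_eq: "f t = (1 - t) *\<^sub>R z + t *\<^sub>R y" for t by (simp add: f_def algebra_simps)
    \<comment> \<open>The homogeneous distance from the plane: a zero of h becomes a point of the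
      plane after normalisation.\<close>
    define h where "h t = lorentz (f t) n - sqrt (- lorentz (f t) (f t))" for t
    have "\<exists>t\<ge>0. t \<le> 1 \<and> h t = 0"
    proof (rule IVT2')
      show "h 1 \<le> 0" "0 \<le> h 0" using y zn by (simp_all add: h_def f_def H2_lorentz[OF y(1)] H2_lorentz[OF zH])
      show "continuous_on {0..1} h" unfolding h_def f_def by (intro continuous_intros)
    qed simp
    then obtain t where t: "0 \<le> t" "t \<le> 1" "h t = 0" by blast
    have "t \<noteq> 0" using t(3) zn by (auto simp: h_def f_def H2_lorentz[OF zH])
    have "z \<in> K" using z unfolding K_def by (intro CollectI exI[of _ 1] exI[of _ z]) simp
    \<comment> \<open>Moving from a point of a convex set towards an interior point leads into the
      interior. This Euclidean fact is the reason for passing to the cone.\<close>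
    then have fK: "f t \<in> interior K"
      unfolding f_def using \<open>convex K\<close> Kint[OF y] t \<open>t \<noteq> 0\<close> by (intro mem_interior_convex_shrink) auto
    have tl: "lorentz (f t) (f t) < 0" "f t $ 3 > 0"
      unfolding f_eq using combination_timelike[OF zH y(1), of "1 - t" t] t by auto
    define r where "r = 1 / sqrt (- lorentz (f t) (f t))"
    have r: "r > 0" using tl by (simp add: r_def)
    define e where "e = r *\<^sub>R f t"
    have e: "e \<in> H2" "lorentz e n = 1"
      using hnormalize_in_H2[OF tl] t(3) tl by (simp_all add: e_def r_def hnormalize_def h_def lorentz_simps)
    have "e \<in> top_of_set H2 interior_of B"
      unfolding interior_of_def
    proof (intro CollectI exI conjI)
      let ?T = "(\<lambda>x. r *\<^sub>R x) ` interior K"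
      show "openin (top_of_set H2) (H2 \<inter> ?T)"
        using open_scaling[of r "interior K"] r by (auto simp: openin_open)
      show "e \<in> H2 \<inter> ?T" using e fK by (auto simp: e_def)
      show "H2 \<inter> ?T \<subseteq> B"
      proof
        fix x assume x: "x \<in> H2 \<inter> ?T"
        then obtain c y where "x = (r * c) *\<^sub>R y" "c > 0" "y \<in> B"
          using interior_subset[of K] by (force simp: K_def)
        then have "x \<in> K" using r unfolding K_def by (intro CollectI exI[of _ "r * c"] exI[of _ y]) simp
        then show "x \<in> B" using KB x by auto
      qed
    qed
    moreover have "e \<in> top_of_set H2 frontier_of B" unfolding B(3) using e by simp
    ultimately show False using fr by simp
  qed
  then show ?thesis using E U BH by (auto simp: order_le_less)
qed

lemma circumball_eq:
  assumes v: "hyperbolic_triangle v" and n: "\<And>k. lorentz (v k) n = 1"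
  shows "circumball v = {x \<in> H2. lorentz x n \<le> 1}"
  unfolding circumball_def circumcircle_eq(1)[OF assms]
proof (rule the_equality)
  note nn = circumcircle_eq(2)[OF assms]
  note H = hyperbolic_triangle_basis[OF v]
  have ne: "v 1 \<noteq> v 2" using H(2) by auto
  show "hconvex {x \<in> H2. lorentz x n \<le> 1} \<and> closedin (top_of_set H2) {x \<in> H2. lorentz x n \<le> 1} \<and>
      top_of_set H2 frontier_of {x \<in> H2. lorentz x n \<le> 1} = {x \<in> H2. lorentz x n = 1}"
    using half_space_hconvex closedin_half_space[of n]
    by (auto simp: frontier_of_def closure_of_closedin interior_half_space[OF nn])
  show "B = {x \<in> H2. lorentz x n \<le> 1}"
    if "hconvex B \<and> closedin (top_of_set H2) B \<and>
      top_of_set H2 frontier_of B = {x \<in> H2. lorentz x n = 1}" for B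
    by (rule circumball_unique[OF nn H(1) n H(1) n ne]) (use that in auto)
qed

lemma interior_circumball:
  assumes v: "hyperbolic_triangle v" and n: "\<And>k. lorentz (v k) n = 1"
  shows "top_of_set H2 interior_of circumball v = {x \<in> H2. lorentz x n < 1}"
  unfolding circumball_eq[OF assms] by (rule interior_half_space[OF circumcircle_eq(2)[OF assms]])

section \<open>Chord lengths and isometries\<close>

text \<open>\<open>chord x y = 2 sinh (hdist x y / 2)\<close> is the Lorentz length of \<open>x - y\<close>.\<close>

definition chord :: "real^3 \<Rightarrow> real^3 \<Rightarrow> real" where
  "chord x y = sqrt (- 2 - 2 * lorentz x y)"

lemma chord_commute: "chord x y = chord y x"
  by (simp add: chord_def lorentz_commute)

lemma chord_nonneg: "x \<in> H2 \<Longrightarrow> y \<in> H2 \<Longrightarrow> chord x y \<ge> 0"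
  using lorentz_H2_le[of x y] by (simp add: chord_def)

lemma chord_pos: "x \<in> H2 \<Longrightarrow> y \<in> H2 \<Longrightarrow> x \<noteq> y \<Longrightarrow> chord x y > 0"
  using lorentz_H2_le[of x y] lorentz_H2_eq[of x y] by (force simp: chord_def)

lemma lorentz_eq_chord: "x \<in> H2 \<Longrightarrow> y \<in> H2 \<Longrightarrow> lorentz x y = - 1 - (chord x y)\<^sup>2 / 2"
  using lorentz_H2_le[of x y] by (simp add: chord_def field_simps)

text \<open>For barycentric coordinates, with sum 1, norm -1 turns into the classical equation of
  the circumcircle in terms of the squared side lengths, here the chords.\<close>

lemma lorentz_combination3:
  assumes "x \<in> H2" "y \<in> H2" "z \<in> H2"
  shows "lorentz (\<alpha> *\<^sub>R x + \<beta> *\<^sub>R y + \<gamma> *\<^sub>R z) (\<alpha> *\<^sub>R x + \<beta> *\<^sub>R y + \<gamma> *\<^sub>R z) =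
    - (\<alpha> + \<beta> + \<gamma>)\<^sup>2 - \<alpha> * \<beta> * (chord x y)\<^sup>2 - \<alpha> * \<gamma> * (chord x z)\<^sup>2 - \<beta> * \<gamma> * (chord y z)\<^sup>2"
  by (simp add: lorentz_simps H2_lorentz assms lorentz_commute[of y x] lorentz_commute[of z x]
      lorentz_commute[of z y] lorentz_eq_chord[OF assms(1,2)] lorentz_eq_chord[OF assms(1,3)]
      lorentz_eq_chord[OF assms(2,3)]) (simp add: power2_eq_square field_simps)

lemma closed_H2: "closed H2"
proof -
  have "H2 = {x. lorentz x x = -1} \<inter> {x::real^3. 0 \<le> x$3}"
  proof (intro equalityI subsetI)
    fix x assume x: "x \<in> {x. lorentz x x = -1} \<inter> {x::real^3. 0 \<le> x$3}"
    have "x$3 \<noteq> 0"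
    proof
      assume "x$3 = 0"
      then have "x$1 * x$1 + x$2 * x$2 = -1" using x by (simp add: lorentz_def)
      then show False using zero_le_square[of "x$1"] zero_le_square[of "x$2"] by linarith
    qed
    then show "x \<in> H2" using x by (auto simp: H2_def)
  qed (auto simp: H2_def)
  moreover have "closed ({x. lorentz x x = -1} \<inter> {x::real^3. 0 \<le> x$3})"
    by (intro closed_Int closed_Collect_eq closed_Collect_le continuous_intros)
  ultimately show ?thesis by simp
qed

text \<open>The form on the left of \<open>e\<close> dominates
  \<open>\<delta> * (X\<^sup>2 + Y\<^sup>2)\<close>, and the squares of
  \<open>\<delta> * X - c\<close> and \<open>\<delta> * Y - b\<close> absorb the linear
  terms.\<close>

lemma quadratic_bound:
  fixes X Y b c \<delta> \<theta> :: real
  assumes \<delta>: "\<delta> > 0" "\<bar>\<theta>\<bar> \<le> 1 - \<delta>" and e: "X\<^sup>2 + Y\<^sup>2 + 2 * \<theta> * (X * Y) = c * X + b * Y"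
  shows "X\<^sup>2 + Y\<^sup>2 \<le> (b\<^sup>2 + c\<^sup>2) / \<delta>\<^sup>2"
proof -
  have "\<bar>2 * (X * Y)\<bar> \<le> X\<^sup>2 + Y\<^sup>2"
    using zero_le_power2[of "X - Y"] zero_le_power2[of "X + Y"]
    unfolding power2_sum power2_diff by linarith
  then have "\<bar>\<theta>\<bar> * \<bar>2 * (X * Y)\<bar> \<le> (1 - \<delta>) * (X\<^sup>2 + Y\<^sup>2)"
    using \<delta> by (intro mult_mono) auto
  then have "\<bar>2 * \<theta> * (X * Y)\<bar> \<le> (1 - \<delta>) * (X\<^sup>2 + Y\<^sup>2)" by (simp add: abs_mult mult_ac)
  then have "\<delta> * (X\<^sup>2 + Y\<^sup>2) \<le> c * X + b * Y" using e by (simp add: algebra_simps)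
  then have "\<delta> * (\<delta> * (X\<^sup>2 + Y\<^sup>2)) \<le> \<delta> * (c * X + b * Y)" using \<delta> by simp
  moreover have "0 \<le> (\<delta> * X - c)\<^sup>2 + (\<delta> * Y - b)\<^sup>2" by simp
  ultimately have "\<delta>\<^sup>2 * (X\<^sup>2 + Y\<^sup>2) \<le> b\<^sup>2 + c\<^sup>2"
    by (simp add: power2_eq_square algebra_simps)
  then show ?thesis using \<delta> by (simp add: field_simps)
qed

lemma compact_of_chords:
  assumes H: "x \<in> H2" "y \<in> H2" "z \<in> H2" and D: "lorentz x (lcross y z) \<noteq> 0"
    and n: "lorentz x n = 1" "lorentz y n = 1" "lorentz z n = 1"
    and ineq: "chord y z < chord x y + chord x z" "chord x z < chord x y + chord y z"
      "chord x y < chord x z + chord y z"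
  shows "compact {w \<in> H2. lorentz w n = 1}"
proof -
  define a b c where "a = chord y z" and "b = chord x z" and "c = chord x y"
  have nn: "a \<ge> 0" "b \<ge> 0" "c \<ge> 0" using H chord_nonneg by (auto simp: a_def b_def c_def)
  have i: "a < b + c" "b < c + a" "c < b + a" using ineq by (auto simp: a_def b_def c_def)
  have pos: "b > 0" "c > 0" using i nn by linarith+
  \<comment> \<open>By the law of cosines this is the cosine of the angle at x in a Euclidean
    triangle with sides a, b, c. The strict triangle inequalities put it strictly between -1 and 1,
    which makes the quadratic equation for w elliptic.\<close>
  define \<theta> where "\<theta> = (b\<^sup>2 + c\<^sup>2 - a\<^sup>2) / (2 * b * c)"
  have "\<bar>b - c\<bar> < a" using i by linarith
  then have "(b - c)\<^sup>2 < a\<^sup>2" using power_strict_mono[of "\<bar>b - c\<bar>" a 2] by simp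
  moreover have "a\<^sup>2 < (b + c)\<^sup>2" using i nn by (intro power_strict_mono) auto
  ultimately have "\<bar>b\<^sup>2 + c\<^sup>2 - a\<^sup>2\<bar> < 2 * b * c" by (simp add: power2_eq_square algebra_simps abs_less_iff)
  then have \<theta>: "\<bar>\<theta>\<bar> < 1" using pos by (simp add: \<theta>_def abs_mult)
  have \<theta>_eq: "b\<^sup>2 + c\<^sup>2 - a\<^sup>2 = 2 * b * c * \<theta>" using pos by (simp add: \<theta>_def)
  define R where "R = sqrt ((b\<^sup>2 + c\<^sup>2) / (1 - \<bar>\<theta>\<bar>)\<^sup>2)"
  have "bounded {w \<in> H2. lorentz w n = 1}"
  proof (rule boundedI)
    fix w assume w: "w \<in> {w \<in> H2. lorentz w n = 1}"
    obtain \<alpha> \<beta> \<gamma> where w_eq: "w = \<alpha> *\<^sub>R x + \<beta> *\<^sub>R y + \<gamma> *\<^sub>R z" using basis_expansion[OF D] by metis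
    have "\<alpha> + \<beta> + \<gamma> = 1" using w n by (simp add: w_eq lorentz_simps)
    then have \<alpha>: "\<alpha> = 1 - \<beta> - \<gamma>" by simp
    have "lorentz w w = -1" using w H2_lorentz by blast
    then have "\<alpha> * \<beta> * c\<^sup>2 + \<alpha> * \<gamma> * b\<^sup>2 + \<beta> * \<gamma> * a\<^sup>2 = 0"
      unfolding w_eq lorentz_combination3[OF H] using \<open>\<alpha> + \<beta> + \<gamma> = 1\<close> by (simp add: a_def b_def c_def)
    then have "(\<beta> * c)\<^sup>2 + (\<gamma> * b)\<^sup>2 + \<beta> * \<gamma> * (b\<^sup>2 + c\<^sup>2 - a\<^sup>2) = c * (\<beta> * c) + b * (\<gamma> * b)"
      unfolding \<alpha> by (simp add: power2_eq_square algebra_simps)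
    then have "(\<beta> * c)\<^sup>2 + (\<gamma> * b)\<^sup>2 + 2 * \<theta> * ((\<beta> * c) * (\<gamma> * b)) = c * (\<beta> * c) + b * (\<gamma> * b)"
      unfolding \<theta>_eq by (simp add: mult_ac)
    then have "(\<beta> * c)\<^sup>2 + (\<gamma> * b)\<^sup>2 \<le> (b\<^sup>2 + c\<^sup>2) / (1 - \<bar>\<theta>\<bar>)\<^sup>2"
      using \<theta> by (intro quadratic_bound) auto
    then have "(\<beta> * c)\<^sup>2 \<le> (b\<^sup>2 + c\<^sup>2) / (1 - \<bar>\<theta>\<bar>)\<^sup>2" "(\<gamma> * b)\<^sup>2 \<le> (b\<^sup>2 + c\<^sup>2) / (1 - \<bar>\<theta>\<bar>)\<^sup>2"
      using zero_le_power2[of "\<beta> * c"] zero_le_power2[of "\<gamma> * b"] by linarith+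
    then have "\<bar>\<beta> * c\<bar> \<le> R" "\<bar>\<gamma> * b\<bar> \<le> R"
      unfolding R_def by (auto intro!: real_le_rsqrt)
    then have \<beta>: "\<bar>\<beta>\<bar> \<le> R / c" and \<gamma>: "\<bar>\<gamma>\<bar> \<le> R / b"
      using pos by (simp_all add: abs_mult field_simps)
    then have "\<bar>\<alpha>\<bar> \<le> 1 + R / c + R / b" unfolding \<alpha> by linarith
    moreover have "norm w \<le> \<bar>\<alpha>\<bar> * norm x + \<bar>\<beta>\<bar> * norm y + \<bar>\<gamma>\<bar> * norm z"
      unfolding w_eq by (intro norm_triangle_le add_mono) auto
    ultimately show "norm w \<le> (1 + R / c + R / b) * norm x + R / c * norm y + R / b * norm z"
      using \<beta> \<gamma> by (smt (verit) mult_right_mono norm_ge_zero)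
  qed
  moreover have "closed (H2 \<inter> {w. lorentz w n = 1})"
    by (intro closed_Int closed_H2 closed_Collect_eq continuous_intros)
  ultimately show ?thesis by (simp add: compact_eq_bounded_closed Collect_conj_eq)
qed

text \<open>
  The conclusion says \<open>\<bar>p - q\<bar> \<ge> a\<close> for the chord lengths \<open>p\<close> and \<open>q\<close> of \<open>w y\<close> and \<open>w z\<close>. It comes from the
  identity for \<open>X\<^sup>2 - 4 p\<^sup>2 q\<^sup>2\<close> in the proof, whose right-hand side is a sum of non-negative terms.
\<close>

lemma opposite_vertex_outside:
  assumes H: "x \<in> H2" "y \<in> H2" "z \<in> H2" "w \<in> H2" and w: "w = \<alpha> *\<^sub>R x + \<beta> *\<^sub>R y + \<gamma> *\<^sub>R z"
    and \<alpha>: "\<alpha> < 0" and out: "\<alpha> + \<beta> + \<gamma> \<ge> 1"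
    and long: "chord y z \<ge> chord x y + chord x z"
  shows "chord w y \<ge> chord y z + chord w z \<or> chord w z \<ge> chord y z + chord w y"
proof -
  define a b c where "a = chord y z" and "b = chord x z" and "c = chord x y"
  define p q where "p = chord w y" and "q = chord w z"
  have nn: "a \<ge> 0" "b \<ge> 0" "c \<ge> 0" "p \<ge> 0" "q \<ge> 0"
    using H chord_nonneg by (auto simp: a_def b_def c_def p_def q_def)
  have abc: "b + c \<le> a" using long by (simp add: a_def b_def c_def)
  \<comment> \<open>\<kappa> measures how far w lies beyond the side y z, and \<tau> how far beyond
    the plane of x, y, z.\<close>
  define \<kappa> \<tau> where "\<kappa> = - \<alpha>" and "\<tau> = \<alpha> + \<beta> + \<gamma> - 1"
  have \<kappa>\<tau>: "\<kappa> > 0" "\<tau> \<ge> 0" using \<alpha> out by (simp_all add: \<kappa>_def \<tau>_def)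
  \<comment> \<open>D is -2bc times what would be the cosine at x in a Euclidean triangle; a long
    side makes it at least 2bc.\<close>
  define D where "D = a\<^sup>2 - b\<^sup>2 - c\<^sup>2"
  have "(b + c)\<^sup>2 \<le> a\<^sup>2" using abc nn by (intro power_mono) auto
  then have D: "D \<ge> 2 * b * c" by (simp add: D_def power2_sum)
  have D0: "D \<ge> 0" "D\<^sup>2 \<ge> (2 * b * c)\<^sup>2"
    using D nn by (auto intro: order_trans[rotated] power_mono)
  have l: "lorentz x y = - 1 - c\<^sup>2 / 2" "lorentz x z = - 1 - b\<^sup>2 / 2" "lorentz y z = - 1 - a\<^sup>2 / 2"
    "lorentz w y = - 1 - p\<^sup>2 / 2" "lorentz w z = - 1 - q\<^sup>2 / 2"
    using lorentz_eq_chord H by (auto simp: a_def b_def c_def p_def q_def)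
  have p2: "p\<^sup>2 = 2 * \<tau> - \<kappa> * c\<^sup>2 + \<gamma> * a\<^sup>2"
  proof -
    have "lorentz w y = \<alpha> * lorentz x y - \<beta> + \<gamma> * lorentz y z"
      by (simp add: w lorentz_simps H2_lorentz H lorentz_commute[of z y])
    then show ?thesis unfolding l by (simp add: \<kappa>_def \<tau>_def field_simps)
  qed
  have q2: "q\<^sup>2 = 2 * \<tau> - \<kappa> * b\<^sup>2 + \<beta> * a\<^sup>2"
  proof -
    have "lorentz w z = \<alpha> * lorentz x z + \<beta> * lorentz y z - \<gamma>"
      by (simp add: w lorentz_simps H2_lorentz H)
    then show ?thesis unfolding l by (simp add: \<kappa>_def \<tau>_def field_simps)
  qed
  have sum: "\<beta> = 1 + \<tau> + \<kappa> - \<gamma>" by (simp add: \<kappa>_def \<tau>_def)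
  have con: "\<beta> * \<gamma> * a\<^sup>2 = \<kappa> * \<beta> * c\<^sup>2 + \<kappa> * \<gamma> * b\<^sup>2 - \<tau> * (\<tau> + 2)"
    using H2_lorentz[OF H(4)] unfolding w lorentz_combination3[OF H(1-3)]
    by (simp add: \<kappa>_def \<tau>_def a_def b_def c_def power2_eq_square algebra_simps)
  define X where "X = p\<^sup>2 + q\<^sup>2 - a\<^sup>2"
  have "X = \<tau> * (4 + a\<^sup>2) + \<kappa> * D"
    unfolding X_def p2 q2 D_def sum by (simp add: algebra_simps)
  then have X0: "X \<ge> 0" using \<kappa>\<tau> D0 by simp
  \<comment> \<open>By Heron's formula the left side is -16 times the squared area of a Euclidean
    triangle with sides a, p, q, so its being non-negative rules out a proper triangle. The sign of
    X then shows that p or q, and not a, is the long side.\<close>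
  have "X\<^sup>2 - 4 * p\<^sup>2 * q\<^sup>2 =
      \<kappa>\<^sup>2 * (D\<^sup>2 - (2 * b * c)\<^sup>2) + 2 * \<tau> * \<kappa> * a\<^sup>2 * D + \<tau>\<^sup>2 * a\<^sup>2 * (a\<^sup>2 + 4)"
  proof -
    have "X\<^sup>2 - 4 * p\<^sup>2 * q\<^sup>2 - (\<kappa>\<^sup>2 * (D\<^sup>2 - (2 * b * c)\<^sup>2) + 2 * \<tau> * \<kappa> * a\<^sup>2 * D + \<tau>\<^sup>2 * a\<^sup>2 * (a\<^sup>2 + 4))
      = - 4 * a\<^sup>2 * (\<beta> * \<gamma> * a\<^sup>2 - (\<kappa> * \<beta> * c\<^sup>2 + \<kappa> * \<gamma> * b\<^sup>2 - \<tau> * (\<tau> + 2)))"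
      unfolding X_def p2 q2 D_def sum by (simp add: power2_eq_square algebra_simps)
    then show ?thesis unfolding con by simp
  qed
  moreover have "\<dots> \<ge> 0" using \<kappa>\<tau> D0 by (intro add_nonneg_nonneg mult_nonneg_nonneg) auto
  ultimately have "(2 * p * q)\<^sup>2 \<le> X\<^sup>2" by (simp add: power_mult_distrib)
  then have "2 * p * q \<le> X" using X0 by (rule power2_le_imp_le)
  then have "a\<^sup>2 \<le> (p - q)\<^sup>2" by (simp add: X_def power2_diff)
  then have "a \<le> \<bar>p - q\<bar>" using nn by (metis abs_le_square_iff abs_of_nonneg)
  then show ?thesis unfolding a_def p_def q_def by linarith
qed

section \<open>Distances within a segment, and isometries\<close>

lemma hdist_commute: "hdist x y = hdist y x"
  by (simp add: hdist_def lorentz_commute)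

lemma hdist_nonneg: "x \<in> H2 \<Longrightarrow> y \<in> H2 \<Longrightarrow> hdist x y \<ge> 0"
  using lorentz_H2_le[of x y] by (simp add: hdist_def)

lemma hdist_eq_0: "x \<in> H2 \<Longrightarrow> y \<in> H2 \<Longrightarrow> hdist x y = 0 \<Longrightarrow> x = y"
  using lorentz_H2_le[of x y] lorentz_H2_eq[of x y] by (simp add: hdist_def)

lemma hdist_eq_imp_lorentz_eq:
  assumes "x \<in> H2" "y \<in> H2" "x' \<in> H2" "y' \<in> H2" "hdist x y = hdist x' y'"
  shows "lorentz x y = lorentz x' y'"
proof -
  have "cosh (hdist u v) = - lorentz u v" if "u \<in> H2" "v \<in> H2" for u v
    unfolding hdist_def by (rule cosh_arcosh_real) (use lorentz_H2_le[OF that] in simp)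
  from this[OF assms(1,2)] this[OF assms(3,4)] show ?thesis using assms(5) by simp
qed

text \<open>The points \<open>a *\<^sub>R p + b *\<^sub>R q\<close> of a segment are ordered by the
  ratio of b to a. Comparing products avoids division by a or c, which may vanish.\<close>

lemma hseg_order:
  assumes H: "p \<in> H2" "q \<in> H2" and s: "s \<in> hseg p q" and t: "t \<in> hseg p q"
  shows "s \<in> hseg p t \<or> t \<in> hseg p s"
proof -
  obtain a b where s': "a \<ge> 0" "b \<ge> 0" "s = a *\<^sub>R p + b *\<^sub>R q" "s \<in> H2" using s hseg_iff[OF H] by auto
  obtain c d where t': "c \<ge> 0" "d \<ge> 0" "t = c *\<^sub>R p + d *\<^sub>R q" "t \<in> H2" using t hseg_iff[OF H] by auto
  have comb: "u \<in> hseg p v"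
    if "u = a *\<^sub>R p + b *\<^sub>R q" "v = c *\<^sub>R p + d *\<^sub>R q" "u \<in> H2" "v \<in> H2" "a \<ge> 0" "b \<ge> 0" "d > 0"
      "a * d \<ge> b * c" for u v a b c d
  proof (rule combination_imp_hseg[OF H(1) that(4,3)])
    show "u = (a - b * c / d) *\<^sub>R p + (b / d) *\<^sub>R v"
      using that by (simp add: algebra_simps)
    show "a - b * c / d \<ge> 0" "b / d \<ge> 0" using that by (simp_all add: field_simps)
  qed
  consider "d > 0" "a * d \<ge> b * c" | "b > 0" "c * b \<ge> d * a" | "b = 0" "d = 0"
  proof (cases "d = 0"; cases "b = 0")
    assume "d = 0" "b \<noteq> 0"
    then show thesis using that(2) s' t' by simp
  next
    assume "d \<noteq> 0" "b = 0"
    then show thesis using that(1) s' t' by simp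
  next
    assume "d \<noteq> 0" "b \<noteq> 0"
    then show thesis using that(1,2) s'(2) t'(2) by (cases "a * d \<ge> b * c") (simp_all add: mult.commute)
  qed (use that(3) in auto)
  then show ?thesis
  proof cases
    case 1
    then show ?thesis using comb[OF s'(3) t'(3) s'(4) t'(4) s'(1) s'(2)] by simp
  next
    case 2
    then show ?thesis using comb[OF t'(3) s'(3) t'(4) s'(4) t'(1) t'(2)] by simp
  next
    case 3
    have "p \<in> hseg p t" using endpoints_in_hseg H(1) t'(4) by blast
    moreover have "s = p"
    proof -
      have "a * a = 1" using H2_lorentz[OF s'(4)] H2_lorentz[OF H(1)] 3 s' by (simp add: lorentz_simps)
      then have "a = 1" using s'(1) by (simp add: power2_eq_square[symmetric] power2_eq_1_iff)
      then show ?thesis using 3 s' by simp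
    qed
    ultimately show ?thesis by simp
  qed
qed

lemma hseg_hdist_le:
  assumes H: "p \<in> H2" "q \<in> H2" and s: "s \<in> hseg p q" and t: "t \<in> hseg p q"
  shows "hdist s t \<le> hdist p q"
    and "hdist s t = hdist p q \<Longrightarrow> s = p \<and> t = q \<or> s = q \<and> t = p"
proof -
  have *: "hdist s t \<le> hdist p q \<and> (hdist s t = hdist p q \<longrightarrow> s = p \<and> t = q)"
    if "s \<in> hseg p t" "t \<in> hseg p q" for s t
  proof -
    have st: "s \<in> H2" "t \<in> H2" using that by (auto simp: hseg_def)
    have "hdist p s + hdist s t = hdist p t" "hdist p t + hdist t q = hdist p q"
      using that by (auto simp: hseg_def)
    moreover have "hdist p s \<ge> 0" "hdist t q \<ge> 0" using hdist_nonneg H st by auto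
    ultimately have "hdist s t \<le> hdist p q"
      "hdist s t = hdist p q \<Longrightarrow> hdist p s = 0 \<and> hdist t q = 0" by linarith+
    then show ?thesis using hdist_eq_0 H st by metis
  qed
  from hseg_order[OF assms]
  have "hdist s t \<le> hdist p q \<and> (hdist s t = hdist p q \<longrightarrow> s = p \<and> t = q \<or> s = q \<and> t = p)"
  proof
    assume "s \<in> hseg p t"
    then show ?thesis using *[OF _ t] by simp
  next
    assume "t \<in> hseg p s"
    then show ?thesis using *[OF _ s] by (simp add: hdist_commute[of s t])
  qed
  then show "hdist s t \<le> hdist p q" "hdist s t = hdist p q \<Longrightarrow> s = p \<and> t = q \<or> s = q \<and> t = p"
    by simp_all
qed

lemma hseg_eqI:
  assumes H: "p \<in> H2" "q \<in> H2" and s: "s \<in> hseg p q" and t: "t \<in> hseg p q"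
    and d: "hdist p s = hdist p t"
  shows "s = t"
  using hseg_order[OF H s t]
proof
  assume "s \<in> hseg p t"
  then have "hdist s t = 0" using d by (simp add: hseg_def)
  then show ?thesis using hdist_eq_0 s t by (simp add: hseg_def)
next
  assume "t \<in> hseg p s"
  then have "hdist t s = 0" using d by (simp add: hseg_def)
  then show ?thesis using hdist_eq_0[of t s] s t by (simp add: hseg_def)
qed

text \<open>The endpoints are the only pair at the full length of a segment. This recovers the
  vertices from a gluing map, of which only the isometry between sides is at hand.\<close>

lemma hseg_isometry_endpoints:
  assumes H: "y \<in> H2" "z \<in> H2" "p \<in> H2" "q \<in> H2"
    and f: "f ` hseg y z = hseg p q" and iso: "\<And>s t. s \<in> hseg y z \<Longrightarrow> t \<in> hseg y z \<Longrightarrow> hdist (f s) (f t) = hdist s t"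
  shows "f y = p \<and> f z = q \<or> f y = q \<and> f z = p"
proof -
  have ends: "y \<in> hseg y z" "z \<in> hseg y z" "p \<in> hseg p q" "q \<in> hseg p q"
    using endpoints_in_hseg H by auto
  obtain s t where s: "s \<in> hseg y z" "f s = p" and t: "t \<in> hseg y z" "f t = q"
    using f ends by (metis image_iff)
  have "hdist p q = hdist s t" using iso[OF s(1) t(1)] s t by simp
  then have le: "hdist p q \<le> hdist y z" using hseg_hdist_le(1)[OF H(1,2) s(1) t(1)] by simp
  have fy: "f y \<in> hseg p q" "f z \<in> hseg p q" using f ends by auto
  have "hdist (f y) (f z) = hdist y z" using iso ends by simp
  then have "hdist (f y) (f z) = hdist p q"
    using hseg_hdist_le(1)[OF H(3,4) fy] le by linarith
  then show ?thesis by (rule hseg_hdist_le(2)[OF H(3,4) fy])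
qed

text \<open>The frame y', z', N' has the same Gram matrix as y, z, N and as y, z, -N, so either
  linear map between frames preserves the form. The sign \<epsilon> is chosen to put
  \<open>G x'\<close> on the other side of the line y z.\<close>

lemma lorentz_isometry_opposite:
  assumes H: "y \<in> H2" "z \<in> H2" "y' \<in> H2" "z' \<in> H2" and ne: "y \<noteq> z"
    and eq: "lorentz y' z' = lorentz y z"
    and D: "lorentz x (lcross y z) \<noteq> 0" "lorentz x' (lcross y' z') \<noteq> 0"
  obtains G where "\<And>s t. lorentz (G s) (G t) = lorentz s t" "G y' = y" "G z' = z"
    "\<And>s. s \<in> H2 \<Longrightarrow> G s \<in> H2" "linear G"
    "lorentz (G x') (lcross y z) * lorentz x (lcross y z) < 0"
proof -
  define C where "C = lorentz y z"
  define K where "K = C\<^sup>2 - 1"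
  have "C < -1" unfolding C_def
    using lorentz_H2_eq[OF H(1,2)] lorentz_H2_le[OF H(1,2)] ne by fastforce
  then have K: "K > 0" unfolding K_def using power_strict_mono[of 1 "- C" 2] by simp
  define N N' where "N = lcross y z" and "N' = lcross y' z'"
  have NN: "lorentz N N = K" "lorentz N' N' = K"
    using H eq by (simp_all add: N_def N'_def lorentz_lcross_lcross H2_lorentz K_def C_def)
  have C: "lorentz y z = C" "lorentz y' z' = C" using eq by (simp_all add: C_def)
  define \<epsilon> where "\<epsilon> = - sgn (lorentz x N) * sgn (lorentz x' N')"
  have \<epsilon>: "\<epsilon> * \<epsilon> = 1" using D by (auto simp: \<epsilon>_def N_def N'_def sgn_if)
  \<comment> \<open>A, B and M are the coordinates in the frame y', z', N', found by inverting its
    Gram matrix.\<close>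
  define A where "A s = (lorentz s y' + C * lorentz s z') / K" for s
  define B where "B s = (lorentz s z' + C * lorentz s y') / K" for s
  define M where "M s = lorentz s N' / K" for s
  define G where "G s = A s *\<^sub>R y + B s *\<^sub>R z + (\<epsilon> * M s) *\<^sub>R N" for s
  have prod: "lorentz (a *\<^sub>R u + b *\<^sub>R v + m *\<^sub>R n) (a' *\<^sub>R u + b' *\<^sub>R v + m' *\<^sub>R n) =
      - (a * a') - b * b' + C * (a * b' + a' * b) + K * (m * m')"
    if "u \<in> H2" "v \<in> H2" "lorentz u v = C" "lorentz n n = K" "n = lcross u v" for u v n a b m a' b' m'
    using that(1-4) by (simp add: lorentz_simps H2_lorentz lorentz_commute[of v u] that(5) algebra_simps)
  have expand: "s = A s *\<^sub>R y' + B s *\<^sub>R z' + M s *\<^sub>R N'" for s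
  proof -
    let ?r = "s - (A s *\<^sub>R y' + B s *\<^sub>R z' + M s *\<^sub>R N')"
    have o: "lorentz y' N' = 0" "lorentz z' N' = 0" "lorentz N' y' = 0" "lorentz N' z' = 0"
      by (simp_all add: N'_def)
    have AB: "- A s + C * B s = lorentz s y'" "C * A s - B s = lorentz s z'"
    proof -
      have "(- A s + C * B s) * K = lorentz s y' * K" "(C * A s - B s) * K = lorentz s z' * K"
        using K by (simp_all add: A_def B_def K_def power2_eq_square algebra_simps)
          (simp_all add: field_simps)
      then show "- A s + C * B s = lorentz s y'" "C * A s - B s = lorentz s z'" using K by auto
    qed
    have "?r = 0"
    proof (rule orthogonal_basis_eq_0[of N' y' z'])
      show "lorentz N' (lcross y' z') \<noteq> 0" using NN K by (simp add: N'_def)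
      show "lorentz N' ?r = 0"
        using K by (simp add: lorentz_simps o NN M_def lorentz_commute[of N' s])
      show "lorentz y' ?r = 0" "lorentz z' ?r = 0"
        using AB by (simp_all add: lorentz_simps o C H2_lorentz H lorentz_commute[of _ s] lorentz_commute[of z' y'] algebra_simps)
    qed
    then show ?thesis by simp
  qed
  have pres: "lorentz (G s) (G t) = lorentz s t" for s t
  proof -
    have "lorentz (G s) (G t) = - (A s * A t) - B s * B t + C * (A s * B t + A t * B s) + K * (\<epsilon> * \<epsilon> * (M s * M t))"
      unfolding G_def by (subst prod[OF H(1,2) C(1) NN(1) N_def]) (simp add: mult_ac)
    also have "\<dots> = lorentz (A s *\<^sub>R y' + B s *\<^sub>R z' + M s *\<^sub>R N') (A t *\<^sub>R y' + B t *\<^sub>R z' + M t *\<^sub>R N')"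
      unfolding \<epsilon> by (subst prod[OF H(3,4) C(2) NN(2) N'_def]) simp
    also have "\<dots> = lorentz s t" by (simp flip: expand)
    finally show ?thesis .
  qed
  have Gy: "G y' = y" "G z' = z"
    using K by (simp_all add: G_def A_def B_def M_def N'_def C H2_lorentz H lorentz_commute[of z' y'])
      (simp_all add: K_def power2_eq_square)
  show thesis
  proof (rule that[of G])
    show "linear G"
      by (rule linearI) (simp_all add: G_def A_def B_def M_def lorentz_simps algebra_simps add_divide_distrib)
    show "G s \<in> H2" if "s \<in> H2" for s
      by (rule H2_memI[OF H(1)]) (use pres[of y' s] pres[of s s] that H lorentz_H2_neg in \<open>auto simp: Gy H2_lorentz\<close>)
    have "lorentz (G x') N = \<epsilon> * lorentz x' N'"
      using K by (simp add: G_def lorentz_simps NN M_def) (simp add: N_def)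
    then have "lorentz (G x') N * lorentz x N = - (\<bar>lorentz x' N'\<bar> * \<bar>lorentz x N\<bar>)"
      by (simp add: \<epsilon>_def abs_sgn mult_ac)
    then show "lorentz (G x') (lcross y z) * lorentz x (lcross y z) < 0"
      using D by (simp add: N_def N'_def)
  qed (use pres Gy in auto)
qed

section \<open>Lifting two adjacent triangles\<close>

lemma numeral_mod_3: "(4::3) = 1" "(5::3) = 2" "(6::3) = 3" "(7::3) = 1"
  by simp_all

lemma exhaust_cyclic_3: "UNIV = {k, k + 1, k + 2 :: 3}"
  using exhaust_3[of k] UNIV_3 by (auto simp: numeral_mod_3)

lemma range_cyclic_3: "range v = {v (k :: 3), v (k + 1), v (k + 2)}"
  unfolding exhaust_cyclic_3[of k] by simp

lemma add_3_cyclic: "k + 1 + 1 = k + (2::3)" "k + 1 + 2 = (k::3)" "k + 2 + 1 = (k::3)" "k + 2 + 2 = k + (1::3)"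
  by (simp_all add: add.assoc)

lemma hyperbolic_triangle_cyclic_basis:
  assumes "hyperbolic_triangle v"
  shows "lorentz (v k) (lcross (v (k + 1)) (v (k + 2))) \<noteq> 0"
proof -
  have cyc: "lorentz y (lcross z x) = lorentz x (lcross y z)" for x y z
    by (simp add: lorentz_def lcross_def algebra_simps)
  have "lorentz (v k) (lcross (v (k + 1)) (v (k + 2))) = lorentz (v 1) (lcross (v 2) (v 3))"
    using exhaust_3[of k] cyc[of "v 2" "v 3" "v 1"] cyc[of "v 1" "v 2" "v 3"]
    by (auto simp: numeral_mod_3)
  then show ?thesis using hyperbolic_triangle_basis(2)[OF assms] by simp
qed

text \<open>The non-negative combinations that lie on \<open>H2\<close> form an
  \<open>hconvex\<close> set containing the vertices. The index k is free, so that the vertex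
  opposite to any given side can be singled out.\<close>

lemma triangle_region_combination:
  assumes v: "hyperbolic_triangle v" and w: "w \<in> triangle_region v"
  obtains \<alpha> \<beta> \<gamma> where "w \<in> H2" "\<alpha> \<ge> 0" "\<beta> \<ge> 0" "\<gamma> \<ge> 0"
    "w = \<alpha> *\<^sub>R v k + \<beta> *\<^sub>R v (k + 1) + \<gamma> *\<^sub>R v (k + 2)"
proof -
  note H = hyperbolic_triangle_basis(1)[OF v]
  let ?C = "{w \<in> H2. \<exists>\<alpha>\<ge>0. \<exists>\<beta>\<ge>0. \<exists>\<gamma>\<ge>0. w = \<alpha> *\<^sub>R v k + \<beta> *\<^sub>R v (k + 1) + \<gamma> *\<^sub>R v (k + 2)}"
  have "hconvex ?C"
    unfolding hconvex_def
  proof (intro conjI ballI subsetI)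
    fix x y z assume x: "x \<in> ?C" and y: "y \<in> ?C" and z: "z \<in> hseg x y"
    from x obtain a1 a2 a3 where x': "x \<in> H2" "a1 \<ge> 0" "a2 \<ge> 0" "a3 \<ge> 0"
      "x = a1 *\<^sub>R v k + a2 *\<^sub>R v (k + 1) + a3 *\<^sub>R v (k + 2)" by auto
    from y obtain b1 b2 b3 where y': "y \<in> H2" "b1 \<ge> 0" "b2 \<ge> 0" "b3 \<ge> 0"
      "y = b1 *\<^sub>R v k + b2 *\<^sub>R v (k + 1) + b3 *\<^sub>R v (k + 2)" by auto
    obtain a b where ab: "a \<ge> 0" "b \<ge> 0" "z = a *\<^sub>R x + b *\<^sub>R y" "z \<in> H2"
      using z hseg_iff[OF x'(1) y'(1)] by auto
    have "z = (a * a1 + b * b1) *\<^sub>R v k + (a * a2 + b * b2) *\<^sub>R v (k + 1) + (a * a3 + b * b3) *\<^sub>R v (k + 2)"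
      unfolding ab(3) x'(5) y'(5) by (simp add: algebra_simps)
    moreover have "a * a1 + b * b1 \<ge> 0" "a * a2 + b * b2 \<ge> 0" "a * a3 + b * b3 \<ge> 0"
      using ab x' y' by simp_all
    ultimately show "z \<in> ?C" using ab(4) by blast
  qed auto
  moreover have "range v \<subseteq> ?C"
  proof -
    have "v k = 1 *\<^sub>R v k + 0 *\<^sub>R v (k + 1) + 0 *\<^sub>R v (k + 2)"
      "v (k + 1) = 0 *\<^sub>R v k + 1 *\<^sub>R v (k + 1) + 0 *\<^sub>R v (k + 2)"
      "v (k + 2) = 0 *\<^sub>R v k + 0 *\<^sub>R v (k + 1) + 1 *\<^sub>R v (k + 2)" by simp_all
    then show ?thesis unfolding range_cyclic_3[of v k] using H zero_le_one
      by (metis (mono_tags, lifting) empty_subsetI insert_subset mem_Collect_eq order_refl)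
  qed
  ultimately have "triangle_region v \<subseteq> ?C" unfolding triangle_region_def by (intro hull_minimal)
  then show thesis using w that by blast
qed

lemma triangle_side_subset_region:
  assumes "hyperbolic_triangle v"
  shows "triangle_side v k \<subseteq> triangle_region v"
proof -
  have "hconvex (triangle_region v)"
    unfolding triangle_region_def
    using assms by (intro hconvex_hull_hconvex) (simp add: hyperbolic_triangle_def)
  moreover have "v j \<in> triangle_region v" for j
    by (simp add: triangle_region_def hull_inc)
  ultimately show ?thesis by (auto simp: triangle_side_def hconvex_def)
qed

text \<open>The first face stays in place, and the second is moved by the isometry that matches the
  glued sides and separates the opposite vertices. The shared vertices may coincide in either order,
  since nothing fixes the orientation of the gluing.\<close>

lemma quadrilateral_lift_exists:
  fixes T :: "('i, 's) triangulated"
  defines "v \<equiv> \<lambda>s. verts T (fst s)"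
  assumes s: "hyperbolic_triangle (v s)" "hyperbolic_triangle (v (mate T s))"
    and glue: "glue T s ` side T s = side T (mate T s)" "isometric_embedding (side T s) (glue T s)"
  defines "k \<equiv> snd s" and "j \<equiv> snd (mate T s)"
  obtains G where "quadrilateral_lift T s (\<lambda>x. x) G"
    "\<And>x y. lorentz (G x) (G y) = lorentz x y" "\<And>x. x \<in> H2 \<Longrightarrow> G x \<in> H2"
    "G (v (mate T s) (j + 1)) = v s (k + 1) \<and> G (v (mate T s) (j + 2)) = v s (k + 2) \<or>
     G (v (mate T s) (j + 1)) = v s (k + 2) \<and> G (v (mate T s) (j + 2)) = v s (k + 1)"
    "lorentz (G (v (mate T s) j)) (lcross (v s (k + 1)) (v s (k + 2))) *
      lorentz (v s k) (lcross (v s (k + 1)) (v s (k + 2))) < 0"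
proof -
  define x y z where "x = v s k" and "y = v s (k + 1)" and "z = v s (k + 2)"
  define u where "u = v (mate T s)"
  define f where "f = glue T s"
  note Hv = hyperbolic_triangle_basis(1)[OF s(1)] and Hu = hyperbolic_triangle_basis(1)[OF s(2), folded u_def]
  have H: "x \<in> H2" "y \<in> H2" "z \<in> H2" using Hv by (auto simp: x_def y_def z_def)
  have D: "lorentz x (lcross y z) \<noteq> 0"
    using hyperbolic_triangle_cyclic_basis[OF s(1), of k] by (simp add: x_def y_def z_def)
  have Du: "lorentz (u j) (lcross (u (j + 1)) (u (j + 2))) \<noteq> 0"
    using hyperbolic_triangle_cyclic_basis[OF s(2), of j] by (simp add: u_def)
  have ne: "y \<noteq> z" using D by (auto simp: lorentz.zero_right)
  have side: "side T s = hseg y z" "side T (mate T s) = hseg (u (j + 1)) (u (j + 2))"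
    by (simp_all add: side_def triangle_side_def y_def z_def u_def v_def k_def j_def)
  have iso: "hdist (f a) (f b) = hdist a b" if "a \<in> hseg y z" "b \<in> hseg y z" for a b
    using glue(2) that by (simp add: isometric_embedding_def side f_def)
  have img: "f ` hseg y z = hseg (u (j + 1)) (u (j + 2))" using glue(1) by (simp add: side f_def)
  have ends: "y \<in> hseg y z" "z \<in> hseg y z" using endpoints_in_hseg H by auto
  have fy: "f y = u (j + 1) \<and> f z = u (j + 2) \<or> f y = u (j + 2) \<and> f z = u (j + 1)"
    by (rule hseg_isometry_endpoints[OF H(2,3) Hu Hu img iso])
  then have fH: "f y \<in> H2" "f z \<in> H2" using Hu by auto
  have anti: "lcross (u (j + 2)) (u (j + 1)) = - lcross (u (j + 1)) (u (j + 2))"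
    by (simp add: lcross_def vec_eq_iff forall_3)
  have D': "lorentz (u j) (lcross (f y) (f z)) \<noteq> 0"
    using fy Du by (auto simp: anti lorentz_simps)
  have eq: "lorentz (f y) (f z) = lorentz y z"
    by (rule hdist_eq_imp_lorentz_eq[OF fH H(2,3) iso[OF ends]])
  obtain G where G: "\<And>a b. lorentz (G a) (G b) = lorentz a b" "G (f y) = y" "G (f z) = z"
    "\<And>a. a \<in> H2 \<Longrightarrow> G a \<in> H2" "linear G" "lorentz (G (u j)) (lcross y z) * lorentz x (lcross y z) < 0"
    using lorentz_isometry_opposite[OF H(2,3) fH ne eq D D'] by metis
  have Gd: "hdist (G a) (G b) = hdist a b" for a b by (simp add: hdist_def G)
  have Gf: "G (f w) = w" if w: "w \<in> hseg y z" for w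
  proof (rule hseg_eqI[OF H(2,3) _ w])
    have "f w \<in> hseg (u (j + 1)) (u (j + 2))" using img w by blast
    then have "f w \<in> H2" by (simp add: hseg_def)
    have d: "hdist y (G (f w)) = hdist y w" "hdist (G (f w)) z = hdist w z"
      using Gd[of "f y" "f w"] Gd[of "f w" "f z"] iso ends w by (simp_all add: G)
    then show "G (f w) \<in> hseg y z" using w G(4)[OF \<open>f w \<in> H2\<close>] by (simp add: hseg_def)
    show "hdist y (G (f w)) = hdist y w" by (rule d)
  qed
  have face: "face T (fst s) = triangle_region (v s)" "face T (fst (mate T s)) = triangle_region u"
    by (simp_all add: face_def v_def u_def)
  have sub: "hseg y z \<subseteq> face T (fst s)" "hseg (u (j + 1)) (u (j + 2)) \<subseteq> face T (fst (mate T s))"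
    using triangle_side_subset_region[OF s(1), of k] triangle_side_subset_region[OF s(2), of j]
    by (simp_all add: face triangle_side_def y_def z_def u_def)
  have "face T (fst s) \<inter> G ` face T (fst (mate T s)) = hseg y z"
  proof (intro equalityI subsetI)
    fix w assume w: "w \<in> hseg y z"
    then have "f w \<in> face T (fst (mate T s))" using img sub by blast
    then have "w \<in> G ` face T (fst (mate T s))" using Gf[OF w] by (metis image_eqI)
    then show "w \<in> face T (fst s) \<inter> G ` face T (fst (mate T s))" using sub w by blast
  next
    fix w assume "w \<in> face T (fst s) \<inter> G ` face T (fst (mate T s))"
    then obtain w' where w: "w \<in> triangle_region (v s)" and w': "w' \<in> triangle_region u" "w = G w'"
      by (auto simp: face)
    obtain \<alpha> \<beta> \<gamma> where 1: "w \<in> H2" "\<alpha> \<ge> 0" "\<beta> \<ge> 0" "\<gamma> \<ge> 0" "w = \<alpha> *\<^sub>R x + \<beta> *\<^sub>R y + \<gamma> *\<^sub>R z"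
      using triangle_region_combination[OF s(1) w, of k] unfolding x_def y_def z_def by metis
    obtain \<alpha>' \<beta>' \<gamma>' where 2: "\<alpha>' \<ge> 0" "w' = \<alpha>' *\<^sub>R u j + \<beta>' *\<^sub>R u (j + 1) + \<gamma>' *\<^sub>R u (j + 2)"
      using triangle_region_combination[OF s(2)[folded u_def] w'(1), of j] by metis
    \<comment> \<open>Pairing with the normal of the edge gives opposite signs on the two faces, so
      a common point has coefficient 0 at x.\<close>
    define N where "N = lcross y z"
    have N: "lorentz y N = 0" "lorentz z N = 0" by (simp_all add: N_def)
    have "lorentz w N = \<alpha> * lorentz x N" by (simp add: 1 lorentz_simps N)
    moreover have "lorentz w N = \<alpha>' * lorentz (G (u j)) N"
    proof -
      have "w = \<alpha>' *\<^sub>R G (u j) + \<beta>' *\<^sub>R G (u (j + 1)) + \<gamma>' *\<^sub>R G (u (j + 2))"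
        unfolding w' 2 using G(5) by (simp add: linear_add linear_scale)
      moreover have "lorentz (G (u (j + 1))) N = 0" "lorentz (G (u (j + 2))) N = 0"
        using fy G N by auto
      ultimately show ?thesis by (simp add: lorentz_simps)
    qed
    ultimately have "\<alpha> * (lorentz x N * lorentz x N) = \<alpha>' * (lorentz (G (u j)) N * lorentz x N)"
      by (metis mult.assoc)
    moreover have "\<dots> \<le> 0" using 2 G(6) by (simp add: N_def mult_nonneg_nonpos)
    moreover have "lorentz x N * lorentz x N > 0" using D by (auto simp: N_def zero_less_mult_iff linorder_neq_iff)
    ultimately have "\<alpha> = 0" using 1(2) by (smt (verit) mult_pos_pos)
    then show "w \<in> hseg y z" using 1 combination_imp_hseg[OF H(2,3) 1(1)] by simp
  qed
  then have "quadrilateral_lift T s (\<lambda>x. x) G"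
    unfolding quadrilateral_lift_def side using Gf
    by (auto simp: isometric_embedding_def Gd f_def face G(4) elim!: triangle_region_combination[OF s(1)]
        triangle_region_combination[OF s(2)[folded u_def]])
  then show thesis
    using that[of G] G fy by (auto simp: x_def y_def z_def u_def)
qed

section \<open>Long sides and their growth across an edge\<close>

definition side_chord :: "('i, 's) triangulated \<Rightarrow> 'i \<times> 3 \<Rightarrow> real" where
  "side_chord T s = chord (verts T (fst s) (snd s + 1)) (verts T (fst s) (snd s + 2))"

text \<open>Equality is included: then the circumcircle is a horocycle, which is not compact
  either.\<close>

definition long_side :: "('i, 's) triangulated \<Rightarrow> 'i \<times> 3 \<Rightarrow> bool" where
  "long_side T s \<longleftrightarrow>
     side_chord T s \<ge> side_chord T (fst s, snd s + 1) + side_chord T (fst s, snd s + 2)"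

lemma compact_circumcircle:
  assumes v: "hyperbolic_triangle (verts T i)" and "\<And>k. \<not> long_side T (i, k)"
  shows "compact (circumcircle (verts T i))"
proof -
  note H = hyperbolic_triangle_basis[OF v]
  obtain n where n: "lorentz (verts T i 1) n = 1" "lorentz (verts T i 2) n = 1" "lorentz (verts T i 3) n = 1"
    using affine_normal_exists[OF H(2)] .
  then have n': "lorentz (verts T i k) n = 1" for k using exhaust_3[of k] by auto
  have "compact {x \<in> H2. lorentz x n = 1}"
    by (rule compact_of_chords[OF H(1) H(1) H(1) H(2) n])
      (use assms(2)[of 1] assms(2)[of 2] assms(2)[of 3] in
        \<open>simp_all add: long_side_def side_chord_def numeral_mod_3 chord_commute[of "verts T i 3"] chord_commute[of "verts T i 2" "verts T i 1"]\<close>)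
  then show ?thesis using circumcircle_eq(1)[OF v n'] by simp
qed

text \<open>The new long side is a side of the neighbour other than the common edge. It exceeds that
  edge by at least the chord of the third side, which is positive because w is off the line of the
  edge.\<close>

lemma long_side_across:
  assumes T: "\<And>i. i \<in> faces T \<Longrightarrow> hyperbolic_triangle (verts T i)"
    and glue: "glue T s ` side T s = side T (mate T s)" "isometric_embedding (side T s) (glue T s)"
    and s: "s \<in> sides T" "mate T s \<in> sides T" and "delaunay T" and long: "long_side T s"
  obtains t where "t \<in> sides T" "long_side T t" "side_chord T t > side_chord T s"
proof -
  define v u where "v = verts T (fst s)" and "u = verts T (fst (mate T s))"
  define k j where "k = snd s" and "j = snd (mate T s)"
  have hv: "hyperbolic_triangle v" and hu: "hyperbolic_triangle u"
    using T s by (auto simp: v_def u_def sides_def)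
  note Hv = hyperbolic_triangle_basis(1)[OF hv] and Hu = hyperbolic_triangle_basis(1)[OF hu]
  obtain G where lift: "quadrilateral_lift T s (\<lambda>x. x) G"
    and G: "\<And>x y. lorentz (G x) (G y) = lorentz x y" "\<And>x. x \<in> H2 \<Longrightarrow> G x \<in> H2"
    and ends: "G (u (j + 1)) = v (k + 1) \<and> G (u (j + 2)) = v (k + 2) \<or>
     G (u (j + 1)) = v (k + 2) \<and> G (u (j + 2)) = v (k + 1)"
    and neg: "lorentz (G (u j)) (lcross (v (k + 1)) (v (k + 2))) *
      lorentz (v k) (lcross (v (k + 1)) (v (k + 2))) < 0"
    using quadrilateral_lift_exists[of T s] hv hu glue unfolding v_def u_def k_def j_def by metis
  define w where "w = G (u j)"
  have Gc: "chord (G a) (G b) = chord a b" for a b by (simp add: chord_def G)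
  obtain n0 where n0: "lorentz (v 1) n0 = 1" "lorentz (v 2) n0 = 1" "lorentz (v 3) n0 = 1"
    using affine_normal_exists[OF hyperbolic_triangle_basis(2)[OF hv]] .
  then have n: "lorentz (v i) n0 = 1" for i using exhaust_3[of i] by auto
  have "w \<notin> top_of_set H2 interior_of circumball v"
    using \<open>delaunay T\<close> s(1) lift unfolding delaunay_def w_def u_def v_def by (auto simp: comp_def)
  moreover have wH: "w \<in> H2" using G(2) Hu by (simp add: w_def)
  ultimately have wn: "lorentz w n0 \<ge> 1" using interior_circumball[OF hv n] by auto
  have D: "lorentz (v k) (lcross (v (k + 1)) (v (k + 2))) \<noteq> 0"
    by (rule hyperbolic_triangle_cyclic_basis[OF hv])
  obtain \<alpha> \<beta> \<gamma> where w: "w = \<alpha> *\<^sub>R v k + \<beta> *\<^sub>R v (k + 1) + \<gamma> *\<^sub>R v (k + 2)"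
    and \<alpha>: "\<alpha> = lorentz w (lcross (v (k + 1)) (v (k + 2))) / lorentz (v k) (lcross (v (k + 1)) (v (k + 2)))"
    using basis_expansion[OF D] .
  \<comment> \<open>The common edge separates w from \<open>v k\<close>, so the coordinate at
    \<open>v k\<close> is negative. The sum of the coordinates is the value of w against
    \<open>n0\<close>, which the Delaunay condition makes at least 1.\<close>
  have "\<alpha> < 0" using neg by (auto simp: \<alpha> w_def mult_less_0_iff divide_less_0_iff)
  moreover have "\<alpha> + \<beta> + \<gamma> \<ge> 1" using wn by (simp add: w lorentz_simps n)
  moreover have "chord (v (k + 1)) (v (k + 2)) \<ge> chord (v k) (v (k + 1)) + chord (v k) (v (k + 2))"
    using long by (simp add: long_side_def side_chord_def add_3_cyclic chord_commute[of "v (k + 2)" "v k"]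
        flip: v_def k_def)
  ultimately have longer: "chord w (v (k + 1)) \<ge> chord (v (k + 1)) (v (k + 2)) + chord w (v (k + 2)) \<or>
      chord w (v (k + 2)) \<ge> chord (v (k + 1)) (v (k + 2)) + chord w (v (k + 1))"
    by (rule opposite_vertex_outside[OF Hv Hv Hv wH w])
  have "lorentz w (lcross (v (k + 1)) (v (k + 2))) \<noteq> 0" using neg by (auto simp: w_def)
  then have "w \<noteq> v (k + 1)" "w \<noteq> v (k + 2)" by auto
  then have pos: "chord w (v (k + 1)) > 0" "chord w (v (k + 2)) > 0"
    using chord_pos[OF wH Hv] by simp_all
  define t1 t2 where "t1 = (fst (mate T s), j + 1)" and "t2 = (fst (mate T s), j + 2)"
  have "t1 \<in> sides T" "t2 \<in> sides T" using s(2) by (auto simp: t1_def t2_def sides_def)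
  have c: "side_chord T s = chord (v (k + 1)) (v (k + 2))"
    "side_chord T t1 = chord w (G (u (j + 2)))" "side_chord T t2 = chord w (G (u (j + 1)))"
    by (simp_all add: side_chord_def t1_def t2_def add_3_cyclic w_def Gc chord_commute[of "u j"] flip: u_def v_def k_def)
  have cm: "side_chord T (fst (mate T s), j) = chord (v (k + 1)) (v (k + 2))"
    using ends Gc[of "u (j + 1)" "u (j + 2)"]
    by (auto simp: side_chord_def chord_commute simp flip: u_def)
  have l1: "long_side T t1 \<longleftrightarrow> side_chord T t1 \<ge> side_chord T t2 + side_chord T s"
    and l2: "long_side T t2 \<longleftrightarrow> side_chord T t2 \<ge> side_chord T s + side_chord T t1"
    using cm c(1) by (simp_all add: long_side_def t1_def t2_def add_3_cyclic)
  \<comment> \<open>Gluing the edge in the other order only exchanges the roles of \<open>t1\<close>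
    and \<open>t2\<close>.\<close>
  show thesis
    using ends longer pos that[OF \<open>t1 \<in> sides T\<close>] that[OF \<open>t2 \<in> sides T\<close>] unfolding l1 l2 c by auto
qed

theorem theorem9:
  fixes S :: "'s topology" and V :: "'s set" and d :: "'s \<Rightarrow> 's \<Rightarrow> real"
    and T :: "('i, 's) triangulated"
  assumes "closed_hyperbolic_polyhedral_surface S V d"
    and "delaunay_triangulation S V d T"
  shows "\<forall>i\<in>faces T. compact (circumcircle (verts T i))"
proof
  fix i assume i: "i \<in> faces T"
  have tri: "triangulation S V T" and geo: "geodesic_in S d T" and del: "delaunay T"
    using assms(2) by (auto simp: delaunay_triangulation_def)
  have hyp: "hyperbolic_triangle (verts T i)" if "i \<in> faces T" for i
    using tri that by (auto simp: triangulation_def)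
  have mate: "mate T s \<in> sides T" "glue T s ` side T s = side T (mate T s)" if "s \<in> sides T" for s
    using tri that by (auto simp: triangulation_def homeomorphism_def)
  have iso: "isometric_embedding (side T s) (glue T s)" if "s \<in> sides T" for s
    using geo that by (auto simp: geodesic_in_def)
  have "finite (sides T)" using tri by (simp add: sides_def triangulation_def)
  define L where "L = {s \<in> sides T. long_side T s}"
  have "L = {}"
  proof (rule ccontr)
    assume "L \<noteq> {}"
    moreover have "finite L" using \<open>finite (sides T)\<close> by (simp add: L_def)
    ultimately have "Max (side_chord T ` L) \<in> side_chord T ` L"
      and "\<And>t. t \<in> L \<Longrightarrow> side_chord T t \<le> Max (side_chord T ` L)" by simp_all
    then obtain s where s: "s \<in> L" and max: "\<And>t. t \<in> L \<Longrightarrow> side_chord T t \<le> side_chord T s"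
      by auto
    then have sT: "s \<in> sides T" "long_side T s" by (auto simp: L_def)
    obtain t where "t \<in> sides T" "long_side T t" "side_chord T t > side_chord T s"
      by (rule long_side_across[OF hyp mate(2)[OF sT(1)] iso[OF sT(1)] sT(1) mate(1)[OF sT(1)] del sT(2)])
    then show False using max[of t] by (simp add: L_def)
  qed
  then show "compact (circumcircle (verts T i))"
    using i by (intro compact_circumcircle hyp) (auto simp: L_def sides_def)
qed

end
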